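(* Consider the closed-loop system described in the context under the static event-triggered gain scheduler. Then there exists a minimal dwell-time between two triggering times, i.e. there exists a constant $\tau>0$, independent of the initial condition $u_0\in L^2(0,1)$, such that $t_{j+1}-t_j\ge\tau$ for all $j\ge 0$. More specifically, $\tau$ satisfies $$\tau=\frac{1}{\varphi}\,\frac{\mu R}{G^2}.$$
   Context: Plant. Let $\varepsilon>0$ and $q\in(-\infty,+\infty]$. Consider, for $x\in[0,1]$, $t\ge 0$, $$u_t(t,x)=\varepsilon u_{xx}(t,x)+\lambda(t,x)u(t,x),\qquad u_x(t,0)=q\,u(t,0),$$ $$u(t,1)=U(t)\ \text{(Dirichlet actuation)}\quad\text{or}\quad u_x(t,1)=U(t)\ \text{(Neumann actuation)},$$ with $u(0,x)=u_0(x)$, $u_0\in L^2(0,1)$. When $q=+\infty$ the condition at $x=0$ is interpreted as the Dirichlet condition $u(t,0)=0$. The result covers both actuation types. Here $\lambda\in C^0(\mathbb{R}_+\times[0,1])$, $\lambda(t,\cdot)\in C^1([0,1])$ for each $t$, there is $\bar\lambda>0$ with $|\lambda(t,x)|\le\bar\lambda$ for all $t\ge0$, $x\in[0,1]$, and (Lipschitz assumption) there is a constant $\varphi>0$ with $|\lambda(t,x)-\lambda(s,x)|\le\varphi|t-s|$ for all $x\in[0,1]$, $t,s\ge0$. $u[t]$ denotes the profile $x\mapsto u(t,x)$; $\|\cdot\|$ and $\langle\cdot,\cdot\rangle$ are the $L^2(0,1)$ norm and inner product. Kernels and control. Let $\bar q=\max\{0,-q\}$ and fix $c\ge\varepsilon\bar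 q^2$ (Dirichlet actuation) or $c\ge\varepsilon\bar q^2+\varepsilon/2$ (Neumann actuation). Given an event time $t_j$, put $b_j(x)=\lambda(t_j,x)$, and for $t\ge t_j$ put $e_j(t,x)=\lambda(t,x)-b_j(x)$, $f_j(t,x)=e_j(t,x)u(t,x)$. Let $K_j$ be the $C^2$ solution on $\{0\le y\le x\le1\}$ (known to exist) of $$K_{j,xx}-K_{j,yy}=\tfrac{b_j(y)+c}{\varepsilon}K_j,\quad K_{j,y}(x,0)=qK_j(x,0),\quad K_j(x,x)=-\tfrac1{2\varepsilon}\int_0^x(b_j(s)+c)\,ds$$ (with $K_j(x,0)=0$ when $q=+\infty$), and define $(\mathcal{K}_jh)(x)=h(x)-\int_0^xK_j(x,y)h(y)\,dy$ for $h\in L^2(0,1)$. For $t\in(t_j,t_{j+1})$ the control is $U(t)=\int_0^1K_j(1,y)u(t,y)\,dy$ (Dirichlet actuation) or $U(t)=K_j(1,1)u(t,1)+\int_0^1K_{j,x}(1,y)u(t,y)\,dy$ (Neumann actuation). Solutions are in the sense $u\in C^0([0,\lim t_j);L^2(0,1))$, $u[t]\in H^2(0,1)$ for $t>0$, $u$ is $C^1$ in time with values in $L^2(0,1)$ away from the event times, and the equations hold away from the event times. Constants. Let $\mu_1$ be the smallest eigenvalue of $h\mapsto-h''$ on the set of $h\in H^2(0,1)$ with $h'(0)=qh(0)$ ($h(0)=0$ if $q=+\infty$) and $h(1)=0$ (Dirichlet actuation) or $h'(1)=0$ (Neumann actuation). Let $\mu=c+\varepsilon\mu_1$ and $$G=1+\sqrt{\frac{\bar\lambda+c}{4\varepsilon}\left(\exp\left(\frac{4(\bar\lambda+c)}{\varepsilon}\right)-1\right)}.$$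 Static event-triggered gain scheduler. Let $R\in(0,1)$ be a design parameter. Set $t_0=0$. Given $t_j$, let $S_j=\{t>t_j:\ \langle\mathcal{K}_ju[t],\mathcal{K}_jf_j[t]\rangle>\mu R\|\mathcal{K}_ju[t]\|^2\}$, where $u[t]$ is the solution for $t\ge t_j$ with the control computed from $K_j$. If $S_j=\emptyset$ the set of event times is $\{t_0,\dots,t_j\}$ (so $t_{j+1}=+\infty$); otherwise $t_{j+1}=\inf S_j$. *)

theory Defs
  imports "HOL-Analysis.Analysis"
begin

text \<open>Elements of \<open>L\<^sup>2(0,1)\<close> are represented by functions \<open>real \<Rightarrow> real\<close>, of which only the
  restriction to \<open>[0,1]\<close> matters, identified up to equality almost everywhere.\<close>

abbreviation I01 :: "real measure" where
  "I01 \<equiv> lebesgue_on {0..1}"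

definition L2 :: "(real \<Rightarrow> real) set" where
  "L2 = {h. h \<in> borel_measurable I01 \<and> integrable I01 (\<lambda>x. (h x)\<^sup>2)}"

definition L2_inner :: "(real \<Rightarrow> real) \<Rightarrow> (real \<Rightarrow> real) \<Rightarrow> real" where
  "L2_inner g h = (LINT x|I01. g x * h x)"

definition L2_norm :: "(real \<Rightarrow> real) \<Rightarrow> real" where
  "L2_norm h = sqrt (L2_inner h h)"

text \<open>\<open>H2 h h1 h2\<close>: \<open>h\<close> is the \<open>C\<^sup>1([0,1])\<close> representative of an element of \<open>H\<^sup>2(0,1)\<close>, with
  classical derivative \<open>h1\<close> and second weak derivative \<open>h2\<close>, i.e. \<open>h1\<close> is absolutely continuous
  on \<open>[0,1]\<close> with \<open>h2\<close> as its square-integrable derivative. Using this representative gives the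
  boundary values \<open>h 0\<close>, \<open>h 1\<close>, \<open>h1 0\<close>, \<open>h1 1\<close> a meaning.\<close>

definition H2 :: "(real \<Rightarrow> real) \<Rightarrow> (real \<Rightarrow> real) \<Rightarrow> (real \<Rightarrow> real) \<Rightarrow> bool" where
  "H2 h h1 h2 \<longleftrightarrow>
     (\<forall>x\<in>{0..1}. (h has_real_derivative h1 x) (at x within {0..1})) \<and>
     h2 \<in> L2 \<and>
     (\<forall>x\<in>{0..1}. h1 x = h1 0 + (LINT y|lebesgue_on {0..x}. h2 y))"

datatype actuation = Dirichlet | Neumann

text \<open>The parameter \<open>q\<close> ranges over \<open>(-\<infinity>,+\<infinity>]\<close>, and \<open>q = \<infinity>\<close> encodes the Dirichlet condition at
  \<open>x = 0\<close>. The arguments \<open>a\<close>, \<open>d\<close> are the value and the derivative at the boundary point.\<close>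

definition left_bc :: "ereal \<Rightarrow> real \<Rightarrow> real \<Rightarrow> bool" where
  "left_bc q a d \<longleftrightarrow> (if q = \<infinity> then a = 0 else d = real_of_ereal q * a)"

fun right_trace :: "actuation \<Rightarrow> real \<Rightarrow> real \<Rightarrow> real" where
  "right_trace Dirichlet a d = a"
| "right_trace Neumann a d = d"

definition qbar :: "ereal \<Rightarrow> real" where
  "qbar q = real_of_ereal (max 0 (- q))"

fun c_lower_bound :: "actuation \<Rightarrow> real \<Rightarrow> ereal \<Rightarrow> real" where
  "c_lower_bound Dirichlet \<epsilon> q = \<epsilon> * (qbar q)\<^sup>2"
| "c_lower_bound Neumann \<epsilon> q = \<epsilon> * (qbar q)\<^sup>2 + \<epsilon> / 2"

definition is_eigenvalue :: "actuation \<Rightarrow> ereal \<Rightarrow> real \<Rightarrow> bool" where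
  "is_eigenvalue act q \<nu> \<longleftrightarrow>
     (\<exists>h h1 h2. H2 h h1 h2 \<and> left_bc q (h 0) (h1 0) \<and> right_trace act (h 1) (h1 1) = 0 \<and>
        (\<exists>x\<in>{0..1}. h x \<noteq> 0) \<and> (AE x in I01. - h2 x = \<nu> * h x))"

definition is_smallest_eigenvalue :: "actuation \<Rightarrow> ereal \<Rightarrow> real \<Rightarrow> bool" where
  "is_smallest_eigenvalue act q \<nu> \<longleftrightarrow>
     is_eigenvalue act q \<nu> \<and> (\<forall>\<nu>'. is_eigenvalue act q \<nu>' \<longrightarrow> \<nu> \<le> \<nu>')"

definition triangle :: "(real \<times> real) set" where
  "triangle = {(x, y). 0 \<le> y \<and> y \<le> x \<and> x \<le> 1}"

text \<open>Partial derivatives on the closed triangle, one-sided on its boundary. The triangle is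
  convex with nonempty interior, so derivatives within it are unique, at the corners too.\<close>

definition D1 :: "(real \<times> real \<Rightarrow> real) \<Rightarrow> real \<times> real \<Rightarrow> real" where
  "D1 K z = frechet_derivative K (at z within triangle) (1, 0)"

definition D2 :: "(real \<times> real \<Rightarrow> real) \<Rightarrow> real \<times> real \<Rightarrow> real" where
  "D2 K z = frechet_derivative K (at z within triangle) (0, 1)"

definition C1_triangle :: "(real \<times> real \<Rightarrow> real) \<Rightarrow> bool" where
  "C1_triangle K \<longleftrightarrow> K differentiable_on triangle \<and>
     continuous_on triangle (D1 K) \<and> continuous_on triangle (D2 K)"

definition C2_triangle :: "(real \<times> real \<Rightarrow> real) \<Rightarrow> bool" where
  "C2_triangle K \<longleftrightarrow> C1_triangle K \<and> C1_triangle (D1 K) \<and> C1_triangle (D2 K)"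

definition is_kernel ::
    "real \<Rightarrow> ereal \<Rightarrow> real \<Rightarrow> (real \<Rightarrow> real) \<Rightarrow> (real \<times> real \<Rightarrow> real) \<Rightarrow> bool" where
  "is_kernel \<epsilon> q c b K \<longleftrightarrow>
     C2_triangle K \<and>
     (\<forall>x y. (x, y) \<in> triangle \<longrightarrow>
        D1 (D1 K) (x, y) - D2 (D2 K) (x, y) = (b y + c) / \<epsilon> * K (x, y)) \<and>
     (\<forall>x\<in>{0..1}. left_bc q (K (x, 0)) (D2 K (x, 0))) \<and>
     (\<forall>x\<in>{0..1}. K (x, x) = - 1 / (2 * \<epsilon>) * (LINT s|lebesgue_on {0..x}. b s + c))"

definition backstepping ::
    "(real \<times> real \<Rightarrow> real) \<Rightarrow> (real \<Rightarrow> real) \<Rightarrow> real \<Rightarrow> real" where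
  "backstepping K h x = h x - (LINT y|lebesgue_on {0..x}. K (x, y) * h y)"

fun feedback :: "actuation \<Rightarrow> (real \<times> real \<Rightarrow> real) \<Rightarrow> (real \<Rightarrow> real) \<Rightarrow> real" where
  "feedback Dirichlet K h = (LINT y|I01. K (1, y) * h y)"
| "feedback Neumann K h = K (1, 1) * h 1 + (LINT y|I01. D1 K (1, y) * h y)"

text \<open>\<open>plant_solution act \<epsilon> q lam U a T E u\<close>: \<open>u\<close> solves the plant on the time interval \<open>[a,T)\<close> with
  input \<open>U\<close>; the times in \<open>E\<close> are those at which the equations are not required to hold. Here
  \<open>u t\<close> is the profile at time \<open>t\<close>, represented for \<open>t > a\<close> by its \<open>C\<^sup>1\<close> representative.\<close>

definition plant_solution ::
    "actuation \<Rightarrow> real \<Rightarrow> ereal \<Rightarrow> (real \<Rightarrow> real \<Rightarrow> real) \<Rightarrow> (real \<Rightarrow> real) \<Rightarrow>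
     real \<Rightarrow> ereal \<Rightarrow> real set \<Rightarrow> (real \<Rightarrow> real \<Rightarrow> real) \<Rightarrow> bool" where
  "plant_solution act \<epsilon> q lam U a T E u \<longleftrightarrow>
     (\<forall>t. a \<le> t \<and> ereal t < T \<longrightarrow>
        u t \<in> L2 \<and>
        ((\<lambda>s. L2_norm (\<lambda>x. u s x - u t x)) \<longlongrightarrow> 0) (at t within {s. a \<le> s \<and> ereal s < T})) \<and>
     (\<exists>ut ux uxx.
        (\<forall>t. a < t \<and> ereal t < T \<longrightarrow> H2 (u t) (ux t) (uxx t)) \<and>
        (\<forall>t. a < t \<and> ereal t < T \<and> t \<notin> E \<longrightarrow>
           ut t \<in> L2 \<and>
           ((\<lambda>s. L2_norm (\<lambda>x. (u s x - u t x) / (s - t) - ut t x)) \<longlongrightarrow> 0) (at t) \<and>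
           ((\<lambda>s. L2_norm (\<lambda>x. ut s x - ut t x)) \<longlongrightarrow> 0)
             (at t within {s. a < s \<and> ereal s < T \<and> s \<notin> E}) \<and>
           (AE x in I01. ut t x = \<epsilon> * uxx t x + lam t x * u t x) \<and>
           left_bc q (u t 0) (ux t 0) \<and>
           right_trace act (u t 1) (ux t 1) = U t))"

definition trigger_set ::
    "(real \<Rightarrow> real \<Rightarrow> real) \<Rightarrow> real \<Rightarrow> real \<Rightarrow> real \<Rightarrow> (real \<times> real \<Rightarrow> real) \<Rightarrow>
     (real \<Rightarrow> real \<Rightarrow> real) \<Rightarrow> real set" where
  "trigger_set lam \<mu> R tj K v =
     {t. t > tj \<and>
        L2_inner (backstepping K (v t)) (backstepping K (\<lambda>x. (lam t x - lam tj x) * v t x))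
          > \<mu> * R * (L2_norm (backstepping K (v t)))\<^sup>2}"

text \<open>The closed loop under the static event-triggered gain scheduler, started at \<open>u0\<close>.
  The event times are the finite values of \<open>te\<close>; after the last event, \<open>te\<close> is \<open>\<infinity>\<close>.
  \<open>K j\<close> is the kernel computed at the \<open>j\<close>-th event, and \<open>v j\<close> is the solution on \<open>[te j, \<infinity>)\<close>
  that starts from the profile of \<open>u\<close> at \<open>te j\<close> and keeps using \<open>K j\<close> forever. The next event is
  determined by \<open>v j\<close>, and \<open>u\<close> follows \<open>v j\<close> until then.\<close>

definition closed_loop ::
    "actuation \<Rightarrow> real \<Rightarrow> ereal \<Rightarrow> real \<Rightarrow> (real \<Rightarrow> real \<Rightarrow> real) \<Rightarrow> real \<Rightarrow> real \<Rightarrow>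
     (real \<Rightarrow> real) \<Rightarrow> (nat \<Rightarrow> ereal) \<Rightarrow> (nat \<Rightarrow> real \<times> real \<Rightarrow> real) \<Rightarrow>
     (nat \<Rightarrow> real \<Rightarrow> real \<Rightarrow> real) \<Rightarrow> (real \<Rightarrow> real \<Rightarrow> real) \<Rightarrow> bool" where
  "closed_loop act \<epsilon> q c lam \<mu> R u0 te K v u \<longleftrightarrow>
     (AE x in I01. u 0 x = u0 x) \<and>
     (\<exists>U. (\<forall>j t. te j < ereal t \<and> ereal t < te (Suc j) \<longrightarrow> U t = feedback act (K j) (u t)) \<and>
          plant_solution act \<epsilon> q lam U 0 (SUP j. te j) {t. \<exists>j. te j = ereal t} u) \<and>
     te 0 = 0 \<and>
     (\<forall>j. te j = \<infinity> \<longrightarrow> te (Suc j) = \<infinity>) \<and>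
     (\<forall>j tj. te j = ereal tj \<longrightarrow>
        is_kernel \<epsilon> q c (lam tj) (K j) \<and>
        plant_solution act \<epsilon> q lam (\<lambda>t. feedback act (K j) (v j t)) tj \<infinity> {} (v j) \<and>
        (AE x in I01. v j tj x = u tj x) \<and>
        (\<forall>t. tj < t \<and> ereal t < te (Suc j) \<longrightarrow> (AE x in I01. v j t x = u t x)) \<and>
        (let S = trigger_set lam \<mu> R tj (K j) (v j)
         in te (Suc j) = (if S = {} then \<infinity> else ereal (Inf S))))"

definition gain_bound :: "real \<Rightarrow> real \<Rightarrow> real \<Rightarrow> real" where
  "gain_bound \<epsilon> c lambar =
     1 + sqrt ((lambar + c) / (4 * \<epsilon>) * (exp (4 * (lambar + c) / \<epsilon>) - 1))"

end

theory Submission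
  imports Defs
begin

text \<open>Write \<open>M = (lambar + c) / \<epsilon>\<close>. A comparison argument along the characteristics of the
  kernel equation gives \<open>\<bar>K(x,y)\<bar> \<le> (3M/4) e\<^bsup>(M+1/4)(x-y)\<^esup>\<close>. Because this majorant is a convolution
  kernel, Gronwall's inequality bounds the inverse of the backstepping transformation as well, and
  both operators have \<open>L\<^sup>2\<close> norm at most \<open>G\<close>. An event at \<open>t\<close> therefore forces, with
  \<open>w = K\<^sub>j u[t]\<close>, the inequality \<open>\<mu> R \<parallel>w\<parallel>\<^sup>2 < \<parallel>w\<parallel> G \<phi> (t - t\<^sub>j) \<parallel>u[t]\<parallel> \<le> G\<^sup>2 \<phi> (t - t\<^sub>j) \<parallel>w\<parallel>\<^sup>2\<close>.
  Positivity of \<open>\<mu>\<close> follows from a Riccati substitution in the eigenvalue equation.\<close>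

subsection \<open>The kernel\<close>

text \<open>The obstacle is that one constant \<open>G\<close> must serve both the transformation
  and its inverse. \<open>G\<close> is 1 plus the L2 norm of \<open>M * exp (2 * M * x)\<close>, so
  the majorant of the kernel and that of the resolvent both have to stay below this function. A
  kernel majorant with factor N and rate \<beta> gives a resolvent majorant with factor N and rate N
  + \<beta>. For N = 3M/4 and \<beta> = M + 1/4 the latter rate is 7M/4 + 1/4; the missing quarter
  of the factor pays for the 1/4 in the rate, since (3/4) exp(1/4) \<le> 1. The 1/4 itself is caused
  by the Robin condition at y = 0: the majorant must grow along that edge at a rate of at least
  \<open>qbar q\<close>, while the lower bound on \<open>c\<close> controls only the square,
  \<open>qbar q\<close> squared \<le> M. From this, \<open>qbar q\<close> \<le> M + 1/4 follows for
  small and large M alike.\<close>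

lemma mixed_partials_eq:
  fixes f fx fy fxy fyx :: "real \<times> real \<Rightarrow> real"
  assumes d: "0 < d"
    and fx: "\<And>s t. s \<in> {x..x+d} \<Longrightarrow> t \<in> {y..y+d} \<Longrightarrow> ((\<lambda>s. f (s, t)) has_real_derivative fx (s, t)) (at s)"
    and fy: "\<And>s t. s \<in> {x..x+d} \<Longrightarrow> t \<in> {y..y+d} \<Longrightarrow> ((\<lambda>t. f (s, t)) has_real_derivative fy (s, t)) (at t)"
    and fxy: "\<And>s t. s \<in> {x..x+d} \<Longrightarrow> t \<in> {y..y+d} \<Longrightarrow> ((\<lambda>t. fx (s, t)) has_real_derivative fxy (s, t)) (at t)"
    and fyx: "\<And>s t. s \<in> {x..x+d} \<Longrightarrow> t \<in> {y..y+d} \<Longrightarrow> ((\<lambda>s. fy (s, t)) has_real_derivative fyx (s, t)) (at s)"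
    and cont: "continuous_on ({x..x+d} \<times> {y..y+d}) fxy" "continuous_on ({x..x+d} \<times> {y..y+d}) fyx"
  shows "fxy (x, y) = fyx (x, y)"
proof -
  let ?Q = "{x..x+d} \<times> {y..y+d}"
  \<comment> \<open>The second difference of \<open>f\<close> over a square of side \<open>h\<close>
    is h squared times a value of \<open>fxy\<close> or of \<open>fyx\<close>, depending on the
    order in which the mean value theorem is applied. Continuity then lets the square shrink to its
    corner.\<close>
  have agree: "\<exists>a\<in>{x..x+h}. \<exists>b\<in>{y..y+h}. \<exists>a'\<in>{x..x+h}. \<exists>b'\<in>{y..y+h}. fxy (a, b) = fyx (a', b')"
    if h: "0 < h" "h \<le> d" for h
  proof -
    have "\<exists>a>x. a < x + h \<and> (f (x + h, y + h) - f (x + h, y)) - (f (x, y + h) - f (x, y))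
        = (x + h - x) * (fx (a, y + h) - fx (a, y))"
      by (rule MVT2[where f = "\<lambda>s. f (s, y + h) - f (s, y)" and f' = "\<lambda>s. fx (s, y + h) - fx (s, y)"])
        (use h in \<open>auto intro!: derivative_intros fx\<close>)
    then obtain a where a: "x < a" "a < x + h"
      and 1: "(f (x + h, y + h) - f (x + h, y)) - (f (x, y + h) - f (x, y)) = h * (fx (a, y + h) - fx (a, y))"
      by auto
    have "\<exists>b>y. b < y + h \<and> fx (a, y + h) - fx (a, y) = (y + h - y) * fxy (a, b)"
      by (rule MVT2[where f = "\<lambda>t. fx (a, t)" and f' = "\<lambda>t. fxy (a, t)"])
        (use h a in \<open>auto intro!: fxy\<close>)
    then obtain b where b: "y < b" "b < y + h" and 2: "fx (a, y + h) - fx (a, y) = h * fxy (a, b)" by auto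
    have "\<exists>b>y. b < y + h \<and> (f (x + h, y + h) - f (x, y + h)) - (f (x + h, y) - f (x, y))
        = (y + h - y) * (fy (x + h, b) - fy (x, b))"
      by (rule MVT2[where f = "\<lambda>t. f (x + h, t) - f (x, t)" and f' = "\<lambda>t. fy (x + h, t) - fy (x, t)"])
        (use h in \<open>auto intro!: derivative_intros fy\<close>)
    then obtain b' where b': "y < b'" "b' < y + h"
      and 3: "(f (x + h, y + h) - f (x, y + h)) - (f (x + h, y) - f (x, y)) = h * (fy (x + h, b') - fy (x, b'))"
      by auto
    have "\<exists>a>x. a < x + h \<and> fy (x + h, b') - fy (x, b') = (x + h - x) * fyx (a, b')"
      by (rule MVT2[where f = "\<lambda>s. fy (s, b')" and f' = "\<lambda>s. fyx (s, b')"])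
        (use h b' in \<open>auto intro!: fyx\<close>)
    then obtain a' where a': "x < a'" "a' < x + h" and 4: "fy (x + h, b') - fy (x, b') = h * fyx (a', b')" by auto
    have "h * (h * fxy (a, b)) = h * (h * fyx (a', b'))"
      using 1 2 3 4 by (simp add: algebra_simps)
    then have "fxy (a, b) = fyx (a', b')" using h by simp
    then show ?thesis using a b a' b' by force
  qed
  define h where "h = (\<lambda>n. d / real (Suc n))"
  have h: "0 < h n" "h n \<le> d" for n using d by (auto simp: h_def field_simps)
  have h0: "h \<longlonglongrightarrow> 0" unfolding h_def by (rule lim_const_over_n[THEN LIMSEQ_Suc])
  have "\<forall>n. \<exists>a b a' b'. a \<in> {x..x+h n} \<and> b \<in> {y..y+h n} \<and> a' \<in> {x..x+h n} \<and> b' \<in> {y..y+h n}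
      \<and> fxy (a, b) = fyx (a', b')"
    using agree[OF h] by blast
  then obtain a b a' b' where ab: "\<And>n. a n \<in> {x..x+h n}" "\<And>n. b n \<in> {y..y+h n}"
      "\<And>n. a' n \<in> {x..x+h n}" "\<And>n. b' n \<in> {y..y+h n}"
    and eq: "\<And>n. fxy (a n, b n) = fyx (a' n, b' n)"
    by metis
  have lim: "u \<longlonglongrightarrow> z" if "\<And>n. u n \<in> {z..z+h n}" for u and z :: real
  proof (rule tendsto_sandwich[of "\<lambda>_. z" u _ "\<lambda>n. z + h n"])
    show "(\<lambda>n. z + h n) \<longlonglongrightarrow> z" using tendsto_add[OF tendsto_const h0, of z] by simp
  qed (use that in auto)
  have inQ: "(u n, v n) \<in> ?Q" if "\<And>n. u n \<in> {x..x+h n}" "\<And>n. v n \<in> {y..y+h n}" for u v n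
    using that[of n] h(2)[of n] by auto
  have "(\<lambda>n. fxy (a n, b n)) \<longlonglongrightarrow> fxy (x, y)"
    by (rule continuous_on_tendsto_compose[OF cont(1)])
      (use d inQ[OF ab(1) ab(2)] in \<open>auto intro!: tendsto_Pair lim[OF ab(1)] lim[OF ab(2)]\<close>)
  moreover have "(\<lambda>n. fyx (a' n, b' n)) \<longlonglongrightarrow> fyx (x, y)"
    by (rule continuous_on_tendsto_compose[OF cont(2)])
      (use d inQ[OF ab(3) ab(4)] in \<open>auto intro!: tendsto_Pair lim[OF ab(3)] lim[OF ab(4)]\<close>)
  ultimately show ?thesis using LIMSEQ_unique by (simp add: eq)
qed

text \<open>The chain rule is kept relative to \<open>S\<close> so that it also covers paths lying
  in the boundary of the triangle: the diagonal and the bottom edge.\<close>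

lemma has_real_derivative_path_triangle:
  assumes K: "K differentiable_on triangle"
    and "(g has_real_derivative a) (at s within S)" "(h has_real_derivative b) (at s within S)"
    and sub: "\<And>s. s \<in> S \<Longrightarrow> (g s, h s) \<in> triangle" and s: "s \<in> S"
  shows "((\<lambda>s. K (g s, h s)) has_real_derivative a * D1 K (g s, h s) + b * D2 K (g s, h s)) (at s within S)"
proof -
  let ?K' = "frechet_derivative K (at (g s, h s) within triangle)"
  have K': "(K has_derivative ?K') (at (g s, h s) within triangle)"
    using K sub[OF s] by (simp add: differentiable_on_def frechet_derivative_works)
  then interpret linear ?K' by (rule has_derivative_linear)
  have gh: "((\<lambda>s. (g s, h s)) has_derivative (\<lambda>r. (a * r, b * r))) (at s within S)"
    using assms(2,3) unfolding has_field_derivative_def by (rule has_derivative_Pair)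
  have "((\<lambda>s. K (g s, h s)) has_derivative (\<lambda>r. ?K' (a * r, b * r))) (at s within S)"
    using has_derivative_in_compose[OF gh has_derivative_subset[OF K']] sub by auto
  moreover have "?K' (a * r, b * r) = (a * D1 K (g s, h s) + b * D2 K (g s, h s)) * r" for r
  proof -
    have "?K' (a * r, b * r) = ?K' ((a * r) *\<^sub>R (1, 0) + (b * r) *\<^sub>R (0, 1))" by simp
    also have "\<dots> = (a * r) * D1 K (g s, h s) + (b * r) * D2 K (g s, h s)"
      unfolding add scale D1_def D2_def by simp
    finally show ?thesis by (simp add: algebra_simps)
  qed
  ultimately show ?thesis unfolding has_field_derivative_def by (simp add: ext)
qed

text \<open>Needed because the derivative of \<open>D1 K + D2 K\<close> in the direction (1, -1)
  contains both mixed derivatives with opposite signs; once they cancel, the left side of the kernel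
  equation remains.\<close>

lemma mixed_partials_triangle:
  assumes C2: "C2_triangle K" and xy: "0 < y" "y < x" "x < 1"
  shows "D2 (D1 K) (x, y) = D1 (D2 K) (x, y)"
proof -
  define d where "d = min (x - y) (1 - x) / 2"
  have d: "0 < d" and xd: "x + d < 1" and yd: "y + d < x"
    using xy unfolding d_def by (auto simp: min_def field_simps)
  have horizontal: "((\<lambda>s. F (s, t)) has_real_derivative D1 F (s, t)) (at s)"
    and vertical: "((\<lambda>t. F (s, t)) has_real_derivative D2 F (s, t)) (at t)"
    if F: "F differentiable_on triangle" and s: "s \<in> {x..x+d}" and t: "t \<in> {y..y+d}" for F s t
  proof -
    have "((\<lambda>s. F (s, t)) has_real_derivative 1 * D1 F (s, t) + 0 * D2 F (s, t)) (at s within {t<..<1})"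
      by (rule has_real_derivative_path_triangle[OF F]) (use s t xy xd yd in \<open>auto simp: triangle_def\<close>)
    moreover have "s \<in> {t<..<1}" using s t xd yd by auto
    ultimately show "((\<lambda>s. F (s, t)) has_real_derivative D1 F (s, t)) (at s)"
      by (simp add: at_within_open[of s "{t<..<1}"])
    have "((\<lambda>t. F (s, t)) has_real_derivative 0 * D1 F (s, t) + 1 * D2 F (s, t)) (at t within {0<..<s})"
      by (rule has_real_derivative_path_triangle[OF F]) (use s t xy xd yd in \<open>auto simp: triangle_def\<close>)
    moreover have "t \<in> {0<..<s}" using s t xy yd by auto
    ultimately show "((\<lambda>t. F (s, t)) has_real_derivative D2 F (s, t)) (at t)"
      by (simp add: at_within_open[of t "{0<..<s}"])
  qed
  have sub: "{x..x+d} \<times> {y..y+d} \<subseteq> triangle"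
    using xd yd xy by (auto simp: triangle_def)
  show ?thesis
  proof (rule mixed_partials_eq[OF d, where f = K and fx = "D1 K" and fy = "D2 K"])
    show "continuous_on ({x..x+d} \<times> {y..y+d}) (D2 (D1 K))" "continuous_on ({x..x+d} \<times> {y..y+d}) (D1 (D2 K))"
      using C2 sub by (auto simp: C2_triangle_def C1_triangle_def intro: continuous_on_subset)
  qed (use C2 in \<open>auto simp: C2_triangle_def C1_triangle_def intro!: horizontal vertical\<close>)
qed

text \<open>\<open>V\<close> plays the role of \<open>K\<^sub>x + K\<^sub>y\<close>. The majorant is a strict supersolution of the Goursat problem;
  at a point with minimal \<open>x\<close> where \<open>\<bar>K\<bar>\<close> would reach it, its domain of dependence lies in the
  region where the bound already holds, and integrating along characteristics gives a contradiction.\<close>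

lemma kernel_comparison:
  fixes K V :: "real \<times> real \<Rightarrow> real"
  assumes contK: "continuous_on triangle K" and contV: "continuous_on triangle V"
    and along: "\<And>r s. 0 \<le> r \<Longrightarrow> 0 < s \<Longrightarrow> r + s < 1 \<Longrightarrow>
        ((\<lambda>s. K (r + s, s)) has_real_derivative V (r + s, s)) (at s)"
    and across: "\<And>d s. 0 < s \<Longrightarrow> s < d \<Longrightarrow> d + s < 1 \<Longrightarrow>
        \<exists>D. ((\<lambda>s. V (d + s, d - s)) has_real_derivative D) (at s) \<and> \<bar>D\<bar> \<le> M * \<bar>K (d + s, d - s)\<bar>"
    and diag: "\<And>d. d \<in> {0..1} \<Longrightarrow> \<bar>V (d, d)\<bar> \<le> M / 2"
    and bc: "(\<forall>r\<in>{0..1}. K (r, 0) = 0) \<or>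
        (\<exists>q\<ge>-p. \<forall>r\<in>{0..1}. ((\<lambda>r. K (r, 0)) has_real_derivative V (r, 0) - q * K (r, 0)) (at r within {0..1}))"
    and K00: "K (0, 0) = 0"
    and M: "0 \<le> M" "M / 2 < A" and \<delta>: "0 < \<delta>" and \<beta>: "0 \<le> p" "p \<le> \<beta>" "M * (A + \<delta>) \<le> 2 * \<beta> * A"
    and xy: "(x, y) \<in> triangle"
  shows "\<bar>K (x, y)\<bar> < (A * x + \<delta>) * exp (\<beta> * (x - y))"
proof (rule ccontr)
  assume notless: "\<not> ?thesis"
  define W where "W = (\<lambda>z. (A * fst z + \<delta>) * exp (\<beta> * (fst z - snd z)))"
  have A: "0 < A" using M by simp
  have Wpos: "0 < W z" if "z \<in> triangle" for z
    using that A \<delta> by (cases z) (auto simp: W_def triangle_def intro!: mult_pos_pos add_nonneg_pos)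
  have contW: "continuous_on triangle W" unfolding W_def by (intro continuous_intros)
  have tri: "compact triangle"
  proof -
    have eq: "triangle = ({0..1} \<times> {0..1}) \<inter> {z. snd z \<le> fst z}" by (auto simp: triangle_def)
    show ?thesis unfolding eq
      by (auto intro!: compact_Int_closed compact_Times closed_Collect_le continuous_intros)
  qed
  define B where "B = triangle \<inter> {z. W z \<le> \<bar>K z\<bar>}"
  have "closedin (top_of_set triangle) (triangle \<inter> (\<lambda>z. W z - \<bar>K z\<bar>) -` {..0})"
    by (intro continuous_closedin_preimage continuous_intros contK contW)
  moreover have "triangle \<inter> (\<lambda>z. W z - \<bar>K z\<bar>) -` {..0} = B" by (auto simp: B_def)
  ultimately have "compact B" using closedin_compact[OF tri] by simp
  moreover have "(x, y) \<in> B" using notless xy by (auto simp: B_def W_def)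
  ultimately obtain z where z: "z \<in> B" and zmin: "\<And>w. w \<in> B \<Longrightarrow> fst z \<le> fst w"
    using continuous_attains_inf[of B fst] continuous_on_fst[OF continuous_on_id] by (metis empty_iff)
  obtain a b where ab: "z = (a, b)" by (cases z)
  have abt: "(a, b) \<in> triangle" and ge: "W (a, b) \<le> \<bar>K (a, b)\<bar>" using z by (auto simp: ab B_def)
  have ab01: "0 \<le> b" "b \<le> a" "a \<le> 1" using abt by (auto simp: triangle_def)
  have less: "\<bar>K w\<bar> < W w" if "w \<in> triangle" "fst w < a" for w
    using zmin[of w] that by (force simp: B_def ab)
  \<comment> \<open>Integration from the diagonal, where \<bar>V\<bar> \<le> M/2, along (d + s, d -
    s). Before its endpoint this path has first coordinate below \<open>a\<close>, so
    \<open>less\<close> applies on it, and \<open>M * (A + \<delta>) \<le> 2 * \<beta> * A\<close>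
    lets the exponential outgrow V. The gap A - M/2 survives as strict slack. The sign
    \<open>\<sigma>\<close> makes a one-sided bound suffice.\<close>
  have Vbound: "\<sigma> * V (u, v) \<le> A * exp (\<beta> * (u - v)) - (A - M / 2)"
    if uv: "(u, v) \<in> triangle" "u \<le> a" and \<sigma>: "\<bar>\<sigma>\<bar> = 1" for u v \<sigma>
  proof -
    define d S where "d = (u + v) / 2" and "S = (u - v) / 2"
    have uv01: "0 \<le> v" "v \<le> u" "u \<le> 1" using uv by (auto simp: triangle_def)
    define \<phi> where "\<phi> = (\<lambda>s. A * exp (2 * \<beta> * s) - \<sigma> * V (d + s, d - s))"
    have "\<phi> 0 \<le> \<phi> S"
    proof (rule DERIV_nonneg_imp_increasing_open[where f = \<phi>])
      show "0 \<le> S" using uv01 by (simp add: S_def)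
      show "continuous_on {0..S} \<phi>" unfolding \<phi>_def
      proof (intro continuous_intros continuous_on_compose2[OF contV])
        show "(\<lambda>s. (d + s, d - s)) ` {0..S} \<subseteq> triangle"
          using uv01 by (auto simp: d_def S_def triangle_def field_simps)
      qed
      fix s assume s: "0 < s" "s < S"
      then have s': "s < d" "d + s < u" using uv01 by (auto simp: d_def S_def field_simps)
      obtain D where D: "((\<lambda>s. V (d + s, d - s)) has_real_derivative D) (at s)"
        and DK: "\<bar>D\<bar> \<le> M * \<bar>K (d + s, d - s)\<bar>"
        using across[of s d] s s' uv01 by auto
      have "\<bar>K (d + s, d - s)\<bar> \<le> W (d + s, d - s)"
        using less[of "(d + s, d - s)"] s s' uv uv01 by (auto simp: triangle_def)
      also have "W (d + s, d - s) \<le> (A + \<delta>) * exp (2 * \<beta> * s)"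
      proof -
        have "A * (d + s) + \<delta> \<le> A + \<delta>" using s' uv01 A by simp
        moreover have "\<beta> * (d + s - (d - s)) = 2 * \<beta> * s" by simp
        ultimately show ?thesis unfolding W_def by (simp only: fst_conv snd_conv mult_right_mono exp_ge_zero)
      qed
      finally have "\<bar>D\<bar> \<le> M * ((A + \<delta>) * exp (2 * \<beta> * s))"
        using DK M by (meson mult_left_mono order_trans)
      also have "\<dots> \<le> 2 * \<beta> * A * exp (2 * \<beta> * s)"
        using \<beta> by (simp flip: mult.assoc)
      finally have "0 \<le> A * (exp (2 * \<beta> * s) * (2 * \<beta>)) - \<sigma> * D"
        using \<sigma> by (auto simp: abs_if algebra_simps split: if_splits)
      moreover have "(\<phi> has_real_derivative A * (exp (2 * \<beta> * s) * (2 * \<beta>)) - \<sigma> * D) (at s)"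
        unfolding \<phi>_def by (auto intro!: derivative_eq_intros D)
      ultimately show "\<exists>y. (\<phi> has_real_derivative y) (at s) \<and> 0 \<le> y" by blast
    qed
    moreover have "\<sigma> * V (d, d) \<le> M / 2"
      using diag[of d] \<sigma> uv01 by (auto simp: abs_if d_def split: if_splits)
    moreover have "d + S = u" "d - S = v" "2 * \<beta> * S = \<beta> * (u - v)" by (auto simp: d_def S_def field_simps)
    ultimately show ?thesis by (simp add: \<phi>_def)
  qed
  have "K (a, b) \<noteq> 0" using ge Wpos[OF abt] by auto
  define \<sigma> where "\<sigma> = sgn (K (a, b))"
  have \<sigma>: "\<bar>\<sigma>\<bar> = 1" "\<sigma> * K (a, b) = \<bar>K (a, b)\<bar>"
    using \<open>K (a, b) \<noteq> 0\<close> by (auto simp: \<sigma>_def abs_sgn_eq mult_sgn_abs sgn_if)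
  have \<sigma>le: "\<sigma> * t \<le> \<bar>t\<bar>" for t using \<sigma>(1) by (auto simp: abs_if split: if_splits)
  show False
  proof (cases "b = 0")
    case False
    then have b: "0 < b" using ab01 by simp
    define r where "r = a - b"
    have r: "0 \<le> r" "r < a" "r + b = a" using ab01 b by (auto simp: r_def)
    define h where "h = (\<lambda>s. W (r + s, s) - \<sigma> * K (r + s, s))"
    \<comment> \<open>The path parallel to the diagonal starts at (r, 0) with r < a, where the bound
      is strict. Along it \<open>W\<close> grows at rate A exp(\<beta> r), which by
      \<open>Vbound\<close> is at least the rate of \<sigma> K, so contact at (a, b) is
      impossible.\<close>
    have "h 0 \<le> h b"
    proof (rule DERIV_nonneg_imp_increasing_open[where f = h])
      have *: "continuous_on {0..b} (\<lambda>s. F (r + s, s))" if "continuous_on triangle F" for F :: "real \<times> real \<Rightarrow> real"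
        by (rule continuous_on_compose2[OF that]) (use r ab01 in \<open>auto intro!: continuous_intros simp: triangle_def\<close>)
      show "continuous_on {0..b} h" unfolding h_def
        by (intro continuous_intros * contW contK)
      fix s assume s: "0 < s" "s < b"
      have "((\<lambda>s. W (r + s, s)) has_real_derivative A * exp (\<beta> * r)) (at s)"
        unfolding W_def by (auto intro!: derivative_eq_intros)
      then have "(h has_real_derivative A * exp (\<beta> * r) - \<sigma> * V (r + s, s)) (at s)"
        unfolding h_def using s r ab01 by (intro DERIV_diff DERIV_cmult along) auto
      moreover have "\<sigma> * V (r + s, s) \<le> A * exp (\<beta> * (r + s - s)) - (A - M / 2)"
        using s r ab01 by (intro Vbound \<sigma>(1)) (auto simp: triangle_def)
      ultimately show "\<exists>y. (h has_real_derivative y) (at s) \<and> 0 \<le> y" using M(2) by (intro exI) auto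
    qed (use b in auto)
    moreover have "0 < h 0"
      using less[of "(r, 0)"] r ab01 \<sigma>le[of "K (r, 0)"] by (auto simp: h_def triangle_def)
    ultimately show False using ge \<sigma> r by (simp add: h_def)
  next
    case True
    then have Kne: "K (a, 0) \<noteq> 0" and ge0: "W (a, 0) \<le> \<bar>K (a, 0)\<bar>" using \<open>K (a, b) \<noteq> 0\<close> ge by auto
    then have a: "0 < a" using K00 ab01 by (cases "a = 0") auto
    obtain q where q: "- p \<le> q"
      and Kq: "((\<lambda>r. K (r, 0)) has_real_derivative V (a, 0) - q * K (a, 0)) (at a within {0..1})"
      using bc Kne ab01 a by force
    define h where "h = (\<lambda>r. W (r, 0) - \<sigma> * K (r, 0))"
    have hpos: "0 < h r" if "0 \<le> r" "r < a" for r
      using less[of "(r, 0)"] that ab01 \<sigma>le[of "K (r, 0)"] by (auto simp: h_def triangle_def)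
    \<comment> \<open>Continuity from the left makes the contact exact, \<bar>K\<bar> = W at (a, 0).
      The Robin term q K can then be expressed through W.\<close>
    have "0 \<le> h a"
    proof (rule continuous_ge_on_closure[where f = h])
      have *: "continuous_on {0..a} (\<lambda>r. F (r, 0))" if "continuous_on triangle F" for F :: "real \<times> real \<Rightarrow> real"
        by (rule continuous_on_compose2[OF that]) (use ab01 in \<open>auto intro!: continuous_intros simp: triangle_def\<close>)
      show "continuous_on (closure {0..<a}) h" unfolding h_def
        using a by (auto intro!: continuous_intros * contW contK)
      show "a \<in> closure {0..<a}" using a by simp
      show "0 \<le> h r" if "r \<in> {0..<a}" for r using hpos[of r] that by auto
    qed
    then have touch: "\<sigma> * K (a, 0) = W (a, 0)" using \<sigma>(2) ge0 True by (simp add: h_def)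
    \<comment> \<open>\<open>D\<close> is the derivative at \<open>a\<close> of \<open>h\<close>,
      which is positive before \<open>a\<close> and zero at \<open>a\<close>. The term \<beta> W
      outweighs q W because -q \<le> p \<le> \<beta>, and the slack of \<open>Vbound\<close> leaves
      D \<ge> A - M/2 > 0, so \<open>h\<close> would be negative just before
      \<open>a\<close>.\<close>
    define D where "D = (A + \<beta> * (A * a + \<delta>)) * exp (\<beta> * a) - \<sigma> * (V (a, 0) - q * K (a, 0))"
    have "(h has_real_derivative D) (at a within {0..1})"
      unfolding h_def W_def D_def by (auto intro!: derivative_eq_intros Kq simp: algebra_simps)
    moreover have "0 < D"
    proof -
      have "\<sigma> * V (a, 0) \<le> A * exp (\<beta> * (a - 0)) - (A - M / 2)"
        by (rule Vbound) (use ab01 \<sigma> in \<open>auto simp: triangle_def\<close>)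
      moreover have "\<sigma> * (V (a, 0) - q * K (a, 0)) = \<sigma> * V (a, 0) - q * W (a, 0)"
        using touch by (simp add: algebra_simps)
      moreover have "- (\<beta> * W (a, 0)) \<le> q * W (a, 0)"
        using mult_right_mono[of "- \<beta>" q "W (a, 0)"] q \<beta> Wpos[OF abt] True by simp
      moreover have "(A + \<beta> * (A * a + \<delta>)) * exp (\<beta> * a) = A * exp (\<beta> * a) + \<beta> * W (a, 0)"
        by (simp add: W_def algebra_simps)
      ultimately show ?thesis using M(2) by (simp add: D_def)
    qed
    ultimately obtain e where e: "e > 0" "\<And>s. 0 < s \<Longrightarrow> a - s \<in> {0..1} \<Longrightarrow> s < e \<Longrightarrow> h (a - s) < h a"
      using has_real_derivative_pos_inc_left by blast
    have "h (a - min (e/2) a) < h a" using e a ab01 by (intro e(2)) auto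
    moreover have "0 < h (a - min (e/2) a)" using a e by (intro hpos) auto
    ultimately show False using touch by (simp add: h_def)
  qed
qed

subsection \<open>The smallest eigenvalue\<close>

text \<open>Although the eigenvalue equation holds only almost everywhere, \<open>h\<close> is
  continuous, so \<open>h1\<close> is the integral of a continuous function and the equation becomes
  classical at every point.\<close>

lemma H2_eigenfunction_derivative:
  assumes H2: "H2 h h1 h2" and eig: "AE x in I01. - h2 x = \<nu> * h x" and x: "x \<in> {0..1}"
  shows "(h1 has_real_derivative - \<nu> * h x) (at x within {0..1})"
proof -
  have conth: "continuous_on {0..1} h"
    using H2 unfolding H2_def by (blast intro: DERIV_continuous_on)
  have h1: "h1 t = h1 0 + integral {0..t} (\<lambda>y. - \<nu> * h y)" if t: "t \<in> {0..1}" for t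
  proof -
    have c: "continuous_on {0..t} (\<lambda>y. - \<nu> * h y)"
      using t by (intro continuous_intros continuous_on_subset[OF conth]) auto
    have "h1 t = h1 0 + (LINT y|lebesgue_on {0..t}. h2 y)"
      using H2 t unfolding H2_def by blast
    also have "(LINT y|lebesgue_on {0..t}. h2 y) = (LINT y|lebesgue_on {0..t}. - \<nu> * h y)"
    proof (rule integral_cong_AE)
      have sub: "lebesgue_on {0..t} = restrict_space I01 {0..t}"
        using t by (simp add: restrict_restrict_space Int_absorb1)
      have "h2 \<in> borel_measurable I01" using H2 by (simp add: H2_def L2_def)
      then show "h2 \<in> borel_measurable (lebesgue_on {0..t})"
        unfolding sub by (rule measurable_restrict_space1)
      show "(\<lambda>y. - \<nu> * h y) \<in> borel_measurable (lebesgue_on {0..t})"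
        by (rule continuous_imp_measurable_on_sets_lebesgue[OF c]) simp
      have "AE y in lebesgue. y \<in> {0..1} \<longrightarrow> - h2 y = \<nu> * h y"
        using eig by (simp add: AE_restrict_space_iff)
      then show "AE y in lebesgue_on {0..t}. h2 y = - \<nu> * h y"
        using t by (auto simp: AE_restrict_space_iff)
    qed
    also have "\<dots> = integral {0..t} (\<lambda>y. - \<nu> * h y)"
      by (rule lebesgue_integral_eq_integral[OF continuous_imp_integrable_real[OF c]]) simp
    finally show ?thesis .
  qed
  have "((\<lambda>t. h1 0 + integral {0..t} (\<lambda>y. - \<nu> * h y)) has_real_derivative 0 + (- \<nu> * h x)) (at x within {0..1})"
    by (intro DERIV_add DERIV_const integral_has_real_derivative x continuous_intros conth)
  then show ?thesis
    unfolding add_0 by (rule has_field_derivative_transform_within[OF _ zero_less_one x]) (rule h1[symmetric])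
qed


lemma constant_on_interval:
  fixes f :: "real \<Rightarrow> real"
  assumes "\<And>x. x \<in> {a..b} \<Longrightarrow> (f has_real_derivative 0) (at x within {a..b})" "x \<in> {a..b}" "y \<in> {a..b}"
  shows "f x = f y"
  using has_field_derivative_zero_constant[of "{a..b}" f] assms by auto

text \<open>With the Riccati substitution \<open>a = - E' / E\<close>, where \<open>E'' = \<kappa> E\<close>, the function \<open>F = h (h' + a h)\<close> satisfies
  \<open>F' = (h' + a h)\<^sup>2 - (\<nu> + \<kappa>) h\<^sup>2\<close>.\<close>

lemma eigenvalue_bound:
  fixes E E' :: "real \<Rightarrow> real"
  assumes E: "\<And>x. x \<in> {0..1} \<Longrightarrow> E x > 0"
    and E': "\<And>x. (E has_real_derivative E' x) (at x)"
    and E2: "\<And>x. (E' has_real_derivative \<kappa> * E x) (at x)"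
    and h: "\<And>x. x \<in> {0..1} \<Longrightarrow> (h has_real_derivative h1 x) (at x within {0..1})"
    and h1: "\<And>x. x \<in> {0..1} \<Longrightarrow> (h1 has_real_derivative - \<nu> * h x) (at x within {0..1})"
    and right: "h 1 * (h1 1 - h 1 * E' 1 / E 1) = 0"
    and left: "0 \<le> h 0 * (h1 0 - h 0 * E' 0 / E 0)"
    and zero: "h 0 * (h1 0 - h 0 * E' 0 / E 0) = 0 \<Longrightarrow> h 0 = 0 \<or> h 1 = 0"
    and nonzero: "x0 \<in> {0..1}" "h x0 \<noteq> 0"
  shows "\<nu> + \<kappa> > 0"
proof (rule ccontr)
  assume neg: "\<not> ?thesis"
  define F where "F = (\<lambda>x. h x * (h1 x - h x * E' x / E x))"
  define F' where "F' = (\<lambda>x. (h1 x - h x * E' x / E x)\<^sup>2 - (\<nu> + \<kappa>) * (h x)\<^sup>2)"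
  have dF: "(F has_real_derivative F' x) (at x within {0..1})" if x: "x \<in> {0..1}" for x
  proof -
    have Ex: "E x \<noteq> 0" using E[OF x] by simp
    note der = DERIV_mult[OF h[OF x] DERIV_diff[OF h1[OF x]
        DERIV_divide[OF DERIV_mult[OF h[OF x] has_field_derivative_at_within[OF E2]]
          has_field_derivative_at_within[OF E'] Ex]]]
    have quot: "((h1 x * E' x + \<kappa> * E x * h x) * E x - h x * E' x * E' x) / (E x * E x)
        = h1 x * (E' x / E x) + \<kappa> * h x - h x * (E' x / E x)\<^sup>2"
      using Ex by (simp add: field_simps power2_eq_square)
    show ?thesis unfolding F_def F'_def
      by (rule DERIV_cong[OF der], unfold quot times_divide_eq_right[symmetric])
        (simp only: power2_eq_square, algebra)
  qed
  have nonpos: "(\<nu> + \<kappa>) * (h x)\<^sup>2 \<le> 0" for x using neg by (intro mult_nonpos_nonneg) auto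
  have F'0: "F' x \<ge> 0" for x using order_trans[OF nonpos zero_le_power2] by (simp add: F'_def)
  have mono: "F x \<le> F y" if "0 \<le> x" "x \<le> y" "y \<le> 1" for x y
  proof (rule DERIV_nonneg_imp_increasing_open[where f = F])
    have "continuous_on {0..1} F" by (rule DERIV_continuous_on) (rule dF)
    then show "continuous_on {x..y} F" by (rule continuous_on_subset) (use that in auto)
    show "\<exists>l. (F has_real_derivative l) (at t) \<and> 0 \<le> l" if "x < t" "t < y" for t
    proof -
      have "t \<in> {0<..<1}" using that \<open>0 \<le> x\<close> \<open>y \<le> 1\<close> by auto
      then have "(F has_real_derivative F' t) (at t)"
        using DERIV_subset[OF dF[of t], of "{0<..<1}"]
        by (simp add: at_within_open[OF \<open>t \<in> {0<..<1}\<close>] subset_eq)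
      then show ?thesis using F'0 by blast
    qed
  qed (use that in auto)
  \<comment> \<open>If \<nu> + \<kappa> \<le> 0 then F is nondecreasing, and 0 \<le> F 0 together
    with F 1 = 0 leaves only F = 0. Both nonnegative terms of \<open>F'\<close> then vanish.\<close>
  have F1: "F 1 = 0" and F0: "0 \<le> F 0" using right left by (auto simp: F_def)
  have Fz: "F x = 0" if "x \<in> {0..1}" for x
    using mono[of 0 x] mono[of x 1] that F1 F0 by auto
  have F'z: "F' x = 0" if x: "x \<in> {0..1}" for x
  proof -
    have "((\<lambda>_. 0) has_real_derivative F' x) (at x within {0..1})"
      by (rule has_field_derivative_transform_within[OF dF[OF x] zero_less_one x]) (simp add: Fz)
    moreover have "((\<lambda>_. 0::real) has_real_derivative 0) (at x within {0..1})" by simp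
    moreover have "at x within {0..1} \<noteq> bot" using x by (simp add: trivial_limit_within islimpt_Icc)
    ultimately show ?thesis by (metis has_field_derivative_unique)
  qed
  have ode: "h1 x = h x * E' x / E x" if x: "x \<in> {0..1}" for x
  proof -
    have "(h1 x - h x * E' x / E x)\<^sup>2 \<le> 0" using F'z[OF x] nonpos[of x] by (simp add: F'_def)
    then show ?thesis by simp
  qed
  \<comment> \<open>The equality case makes \<open>h\<close> a multiple of the positive function
    \<open>E\<close>; the endpoint zero supplied by \<open>zero\<close> then forces
    \<open>h = 0\<close>.\<close>
  have const: "h x / E x = h y / E y" if "x \<in> {0..1}" "y \<in> {0..1}" for x y
  proof (rule constant_on_interval[OF _ that])
    fix x :: real assume x: "x \<in> {0..1}"
    show "((\<lambda>x. h x / E x) has_real_derivative 0) (at x within {0..1})"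
      using E[OF x] ode[OF x]
      by (auto intro!: derivative_eq_intros h DERIV_subset[OF E'] x simp: field_simps)
  qed
  have "h 0 = 0 \<or> h 1 = 0" using zero Fz[of 0] by (simp add: F_def)
  then have "h x0 / E x0 = 0" using const[of x0 0] const[of x0 1] nonzero by auto
  then show False using nonzero E[of x0] by simp
qed


lemma cosh_sq_gt:
  fixes k :: real
  assumes "k \<noteq> 0" shows "2 * k\<^sup>2 < (cosh k)\<^sup>2"
proof -
  \<comment> \<open>The Taylor polynomial of degree 4 suffices; that of degree 2 fails at \<open>k = \<surd>2\<close>.\<close>
  have "(\<Sum>n\<in>{0, 2, 4}. if even n then k ^ n /\<^sub>R fact n else 0) \<le> cosh k"
    unfolding sums_unique[OF cosh_converges]
    by (rule sum_le_suminf) (auto intro: sums_summable[OF cosh_converges] simp: zero_le_even_power)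
  then have "1 + k\<^sup>2 / 2 + k ^ 4 / 24 \<le> cosh k"
    by (simp add: fact_numeral)
  then have "(1 + k\<^sup>2 / 2 + k ^ 4 / 24)\<^sup>2 \<le> (cosh k)\<^sup>2"
    by (rule power_mono) (simp add: add_nonneg_nonneg)
  moreover have "(1 + k\<^sup>2 / 2 + k ^ 4 / 24)\<^sup>2 - 2 * k\<^sup>2
      = (1 - k\<^sup>2 / 2)\<^sup>2 + k ^ 4 / 12 + k ^ 6 / 24 + k ^ 8 / 576"
    by (simp add: power2_eq_square power4_eq_xxxx eval_nat_numeral algebra_simps)
  moreover have "0 \<le> (1 - k\<^sup>2 / 2)\<^sup>2 + k ^ 6 / 24 + k ^ 8 / 576" by simp
  moreover have "0 < k ^ 4 / 12" using assms by simp
  ultimately show ?thesis by linarith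
qed

lemma qbar_cases:
  assumes "- \<infinity> < q"
  obtains "q = \<infinity>" "qbar q = 0" | r where "q = ereal r" "qbar q = max 0 (- r)"
  using assms by (cases q) (auto simp: qbar_def max_def zero_ereal_def split: if_splits)

text \<open>The comparison function \<open>E\<close> must fit the right boundary condition and
  satisfy -E'(0)/E(0) \<ge> \<open>qbar q\<close> on the left. For Dirichlet actuation h(1) = 0
  leaves \<open>E\<close> free, and the exponential with \<kappa> = \<open>qbar q\<close> squared
  uses up exactly the bound on \<open>c\<close>. For Neumann actuation E'(1) = 0 is required, hence
  the cosh centred at 1.\<close>

lemma eigenvalue_shift_pos:
  assumes q: "- \<infinity> < q" and \<epsilon>: "\<epsilon> > 0" and c: "c \<ge> c_lower_bound act \<epsilon> q"
    and ev: "is_eigenvalue act q \<nu>"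
  shows "c + \<epsilon> * \<nu> > 0"
proof -
  obtain h h1 h2 x0 where H2: "H2 h h1 h2" and lbc: "left_bc q (h 0) (h1 0)"
    and rbc: "right_trace act (h 1) (h1 1) = 0"
    and x0: "x0 \<in> {0..1}" "h x0 \<noteq> 0" and eig: "AE x in I01. - h2 x = \<nu> * h x"
    using ev by (auto simp: is_eigenvalue_def)
  have h: "(h has_real_derivative h1 x) (at x within {0..1})" if "x \<in> {0..1}" for x
    using H2 that unfolding H2_def by blast
  note h1 = H2_eigenfunction_derivative[OF H2 eig]
  \<comment> \<open>Here \<open>a\<close> stands for -E'(0)/E(0).\<close>
  have left: "0 \<le> h 0 * (h1 0 + a * h 0)" if "qbar q \<le> a" for a
    using q
  proof (cases rule: qbar_cases)
    case 1 then show ?thesis using lbc by (simp add: left_bc_def)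
  next
    case (2 r)
    then have "h 0 * (h1 0 + a * h 0) = (r + a) * (h 0)\<^sup>2"
      using lbc by (simp add: left_bc_def algebra_simps power2_eq_square)
    then show ?thesis using 2 that by simp
  qed
  have left0: "h 0 = 0" if "qbar q < a" "h 0 * (h1 0 + a * h 0) = 0" for a
    using q
  proof (cases rule: qbar_cases)
    case 1 then show ?thesis using lbc by (simp add: left_bc_def)
  next
    case (2 r)
    then have "h 0 * (h1 0 + a * h 0) = (r + a) * (h 0)\<^sup>2"
      using lbc by (simp add: left_bc_def algebra_simps power2_eq_square)
    then show ?thesis using 2 that by simp
  qed
  have "\<exists>\<kappa>. c \<ge> \<epsilon> * \<kappa> \<and> \<nu> + \<kappa> > 0"
  proof (cases act)
    case Dirichlet
    define E where "E = (\<lambda>x. exp (- qbar q * x))"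
    have "\<nu> + (qbar q)\<^sup>2 > 0"
    proof (rule eigenvalue_bound[where E = E and E' = "\<lambda>x. - qbar q * E x", OF _ _ _ h h1 _ _ _ x0])
      show "0 \<le> h 0 * (h1 0 - h 0 * (- qbar q * E 0) / E 0)"
        using left[of "qbar q"] by (simp add: E_def mult_ac)
    qed (use Dirichlet rbc in \<open>auto simp: E_def power2_eq_square intro!: derivative_eq_intros\<close>)
    then show ?thesis using c Dirichlet by auto
  next
    case Neumann
    define k where "k = sqrt ((qbar q)\<^sup>2 + 1/2)"
    have k2: "k\<^sup>2 = (qbar q)\<^sup>2 + 1/2" and k0: "0 < k"
      by (auto simp: k_def add_nonneg_pos)
    \<comment> \<open>This is where \<epsilon>/2 in the Neumann bound enters: the square of k tanh k
      is that of k minus that of k / cosh k, and the loss is less than 1/2 by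
      \<open>cosh_sq_gt\<close>. Strictness is what later yields h(0) = 0 in the equality
      case.\<close>
    have "qbar q < k * tanh k"
    proof -
      have "(cosh k)\<^sup>2 = (sinh k)\<^sup>2 + 1" by (rule cosh_square_eq)
      then have "(qbar q)\<^sup>2 * (cosh k)\<^sup>2 < k\<^sup>2 * (sinh k)\<^sup>2"
        using cosh_sq_gt[of k] k0 k2 by (simp add: algebra_simps)
      then have "qbar q * cosh k < k * sinh k"
        by (metis power_mult_distrib power2_less_imp_less k0 less_imp_le mult_nonneg_nonneg sinh_real_nonneg_iff)
      then show ?thesis by (simp add: tanh_def field_simps cosh_real_pos)
    qed
    note ka = this
    define E E1 where "E = (\<lambda>x. cosh (k * (1 - x)))" and "E1 = (\<lambda>x. - k * sinh (k * (1 - x)))"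
    have E0: "h 0 * (h1 0 - h 0 * E1 0 / E 0) = h 0 * (h1 0 + (k * tanh k) * h 0)"
      by (simp add: E_def E1_def tanh_def mult_ac)
    have "\<nu> + k\<^sup>2 > 0"
    proof (rule eigenvalue_bound[where E = E and E' = E1, OF _ _ _ h h1 _ _ _ x0])
      show "0 \<le> h 0 * (h1 0 - h 0 * E1 0 / E 0)" unfolding E0 using ka by (intro left) simp
      show "h 0 = 0 \<or> h 1 = 0" if "h 0 * (h1 0 - h 0 * E1 0 / E 0) = 0"
        using left0[OF ka] that unfolding E0 by simp
    qed (use Neumann rbc in \<open>auto simp: E_def E1_def power2_eq_square cosh_real_pos intro!: derivative_eq_intros\<close>)
    then show ?thesis using c Neumann k2 by (intro exI[of _ "k\<^sup>2"]) (auto simp: algebra_simps)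
  qed
  then obtain \<kappa> where "c \<ge> \<epsilon> * \<kappa>" "\<epsilon> * (\<nu> + \<kappa>) > 0" using \<epsilon> by auto
  then show ?thesis by (simp add: algebra_simps)
qed

subsection \<open>The kernel bound\<close>

lemma kernel_bound:
  assumes \<epsilon>: "\<epsilon> > 0" and q: "- \<infinity> < q" and ker: "is_kernel \<epsilon> q c b K"
    and b: "continuous_on {0..1} b" and M: "M > 0" "(qbar q)\<^sup>2 \<le> M"
    and bM: "\<And>y. y \<in> {0..1} \<Longrightarrow> \<bar>b y + c\<bar> / \<epsilon> \<le> M"
    and xy: "(x, y) \<in> triangle"
  shows "\<bar>K (x, y)\<bar> \<le> 3 * M / 4 * exp ((M + 1/4) * (x - y))"
proof -
  define V where "V = (\<lambda>z. D1 K z + D2 K z)"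
  have C2: "C2_triangle K"
    and pde: "\<And>x y. (x, y) \<in> triangle \<Longrightarrow> D1 (D1 K) (x, y) - D2 (D2 K) (x, y) = (b y + c) / \<epsilon> * K (x, y)"
    and lbc: "\<And>x. x \<in> {0..1} \<Longrightarrow> left_bc q (K (x, 0)) (D2 K (x, 0))"
    and diag: "\<And>x. x \<in> {0..1} \<Longrightarrow> K (x, x) = - 1 / (2 * \<epsilon>) * (LINT s|lebesgue_on {0..x}. b s + c)"
    using ker by (auto simp: is_kernel_def)
  have d: "K differentiable_on triangle" "D1 K differentiable_on triangle" "D2 K differentiable_on triangle"
    and contV: "continuous_on triangle V"
    using C2 unfolding V_def C2_triangle_def C1_triangle_def by (auto intro!: continuous_intros)
  have contK: "continuous_on triangle K" using d(1) by (rule differentiable_imp_continuous_on)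
  have diag': "K (x, x) = - 1 / (2 * \<epsilon>) * integral {0..x} (\<lambda>s. b s + c)" if "x \<in> {0..1}" for x
  proof -
    have "continuous_on {0..x} (\<lambda>s. b s + c)"
      using that by (intro continuous_intros continuous_on_subset[OF b]) auto
    from lebesgue_integral_eq_integral[OF continuous_imp_integrable_real[OF this]]
    show ?thesis using diag[OF that] by simp
  qed
  \<comment> \<open>The choice is A = 5M/8 and \<delta> = M/8: A exceeds the diagonal bound M/2
    strictly, and A x + \<delta> is at most 3M/4 on the triangle.\<close>
  have "\<bar>K (x, y)\<bar> < (5 * M / 8 * x + M / 8) * exp ((M + 1/4) * (x - y))"
  proof (rule kernel_comparison[OF contK contV _ _ _ _ _ _ _ _ _ _ _ xy, where M = M and p = "qbar q"])
    fix r s :: real assume "0 \<le> r" "0 < s" "r + s < 1"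
    then have s: "s \<in> {0<..<1 - r}" and r: "0 \<le> r" by auto
    have "((\<lambda>s. K (r + s, s)) has_real_derivative 1 * D1 K (r + s, s) + 1 * D2 K (r + s, s))
        (at s within {0<..<1 - r})"
      by (rule has_real_derivative_path_triangle[OF d(1) _ _ _ s])
        (use r in \<open>auto intro!: derivative_eq_intros simp: triangle_def\<close>)
    then show "((\<lambda>s. K (r + s, s)) has_real_derivative V (r + s, s)) (at s)"
      using s by (simp add: V_def at_within_open[OF s])
  next
    fix d s :: real assume ds: "0 < s" "s < d" "d + s < 1"
    then have s: "s \<in> {0<..<min d (1 - d)}" by auto
    have tri: "(d + s, d - s) \<in> triangle" using ds by (auto simp: triangle_def)
    have path: "((\<lambda>s. F (d + s, d - s)) has_real_derivative D1 F (d + s, d - s) - D2 F (d + s, d - s)) (at s)"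
      if F: "F differentiable_on triangle" for F
    proof -
      have "((\<lambda>s. F (d + s, d - s)) has_real_derivative
          1 * D1 F (d + s, d - s) + (- 1) * D2 F (d + s, d - s)) (at s within {0<..<min d (1 - d)})"
        by (rule has_real_derivative_path_triangle[OF F _ _ _ s])
          (auto intro!: derivative_eq_intros simp: triangle_def)
      then show ?thesis by (simp add: at_within_open[OF s])
    qed
    have mixed: "D2 (D1 K) (d + s, d - s) = D1 (D2 K) (d + s, d - s)"
      by (rule mixed_partials_triangle[OF C2]) (use ds in auto)
    have "((\<lambda>s. V (d + s, d - s)) has_real_derivative (b (d - s) + c) / \<epsilon> * K (d + s, d - s)) (at s)"
      unfolding V_def
      by (rule DERIV_cong[OF DERIV_add[OF path[OF d(2)] path[OF d(3)]]])
        (use mixed pde[OF tri] in simp)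
    moreover have "\<bar>(b (d - s) + c) / \<epsilon> * K (d + s, d - s)\<bar> \<le> M * \<bar>K (d + s, d - s)\<bar>"
      using bM[of "d - s"] ds \<epsilon> unfolding abs_mult abs_divide by (intro mult_right_mono) auto
    ultimately show "\<exists>D. ((\<lambda>s. V (d + s, d - s)) has_real_derivative D) (at s) \<and> \<bar>D\<bar> \<le> M * \<bar>K (d + s, d - s)\<bar>"
      by blast
  next
    fix x :: real assume x: "x \<in> {0..1}"
    have "((\<lambda>s. K (s, s)) has_real_derivative 1 * D1 K (x, x) + 1 * D2 K (x, x)) (at x within {0..1})"
      by (rule has_real_derivative_path_triangle[OF d(1) _ _ _ x])
        (auto intro!: derivative_eq_intros simp: triangle_def)
    moreover have "((\<lambda>s. K (s, s)) has_real_derivative - 1 / (2 * \<epsilon>) * (b x + c)) (at x within {0..1})"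
    proof (rule has_field_derivative_transform_within[OF _ zero_less_one x])
      show "((\<lambda>x. - 1 / (2 * \<epsilon>) * integral {0..x} (\<lambda>s. b s + c)) has_real_derivative
          - 1 / (2 * \<epsilon>) * (b x + c)) (at x within {0..1})"
        by (intro DERIV_cmult integral_has_real_derivative x continuous_intros b)
    qed (rule diag'[symmetric])
    moreover have "at x within {0..1} \<noteq> bot" using x by (simp add: trivial_limit_within islimpt_Icc)
    ultimately have "V (x, x) = - 1 / (2 * \<epsilon>) * (b x + c)"
      by (simp add: V_def) (metis has_field_derivative_unique)
    then have "\<bar>V (x, x)\<bar> = (\<bar>b x + c\<bar> / \<epsilon>) / 2" using \<epsilon> by (simp add: abs_mult)
    then show "\<bar>V (x, x)\<bar> \<le> M / 2" using bM[OF x] by simp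
  next
    show "(\<forall>r\<in>{0..1}. K (r, 0) = 0) \<or> (\<exists>q'\<ge>- qbar q. \<forall>r\<in>{0..1}.
        ((\<lambda>r. K (r, 0)) has_real_derivative V (r, 0) - q' * K (r, 0)) (at r within {0..1}))"
      using q
    proof (cases rule: qbar_cases)
      case 1 then show ?thesis using lbc by (simp add: left_bc_def)
    next
      case (2 q')
      have "((\<lambda>r. K (r, 0)) has_real_derivative V (r, 0) - q' * K (r, 0)) (at r within {0..1})"
        if r: "r \<in> {0..1}" for r
      proof -
        have "((\<lambda>r. K (r, 0)) has_real_derivative 1 * D1 K (r, 0) + 0 * D2 K (r, 0)) (at r within {0..1})"
          by (rule has_real_derivative_path_triangle[OF d(1) _ _ _ r]) (auto simp: triangle_def)
        then show ?thesis using lbc[OF r] 2 by (simp add: V_def left_bc_def)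
      qed
      moreover have "- qbar q \<le> q'" using 2 by simp
      ultimately show ?thesis by blast
    qed
  next
    show "K (0, 0) = 0" using diag'[of 0] by simp
    \<comment> \<open>The square of \<open>qbar q - 1/2\<close> is nonnegative, so
      \<open>qbar q\<close> is at most its own square plus 1/4.\<close>
    show "qbar q \<le> M + 1/4"
      using M zero_le_power2[of "qbar q - 1/2"] by (simp add: power2_eq_square algebra_simps)
    show "0 \<le> qbar q" using q by (cases rule: qbar_cases) auto
    show "M * (5 * M / 8 + M / 8) \<le> 2 * (M + 1/4) * (5 * M / 8)"
      using M by (simp add: algebra_simps)
  qed (use M in auto)
  also have "\<dots> \<le> 3 * M / 4 * exp ((M + 1/4) * (x - y))"
    using xy M by (intro mult_right_mono) (auto simp: triangle_def field_simps)
  finally show ?thesis by simp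
qed

subsection \<open>The space of square-integrable functions\<close>

lemma L2_integrable_mult:
  assumes "g \<in> L2" "h \<in> L2"
  shows "integrable I01 (\<lambda>x. g x * h x)"
proof (rule Bochner_Integration.integrable_bound)
  show "integrable I01 (\<lambda>x. (g x)\<^sup>2 + (h x)\<^sup>2)" using assms by (auto simp: L2_def)
  show "(\<lambda>x. g x * h x) \<in> borel_measurable I01" using assms by (auto simp: L2_def)
  have "\<bar>a * b\<bar> \<le> a\<^sup>2 + b\<^sup>2" for a b :: real
    using zero_le_power2[of "a + b"] zero_le_power2[of "a - b"] zero_le_power2[of a] zero_le_power2[of b]
    unfolding power2_sum power2_diff abs_le_iff by linarith
  then show "AE x in I01. norm (g x * h x) \<le> norm ((g x)\<^sup>2 + (h x)\<^sup>2)" by simp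
qed

lemma continuous_in_L2: "continuous_on {0..1} h \<Longrightarrow> h \<in> L2"
  unfolding L2_def
  by (auto intro!: continuous_imp_measurable_on_sets_lebesgue continuous_imp_integrable_real continuous_intros)

lemma L2_integrable: "h \<in> L2 \<Longrightarrow> integrable I01 h"
  using L2_integrable_mult[of h "\<lambda>_. 1"] continuous_in_L2[of "\<lambda>_. 1"] by simp

lemma L2_abs: "h \<in> L2 \<Longrightarrow> (\<lambda>x. \<bar>h x\<bar>) \<in> L2"
  by (auto simp: L2_def)

lemma L2_cmult: "h \<in> L2 \<Longrightarrow> (\<lambda>x. a * h x) \<in> L2"
  by (auto simp: L2_def power_mult_distrib)

lemma L2_diff:
  assumes "g \<in> L2" "h \<in> L2" shows "(\<lambda>x. g x - h x) \<in> L2"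
proof -
  have "integrable I01 (\<lambda>x. (g x)\<^sup>2 - 2 * (g x * h x) + (h x)\<^sup>2)"
    using assms L2_integrable_mult[OF assms] by (auto simp: L2_def)
  then show ?thesis using assms by (auto simp: L2_def power2_diff algebra_simps)
qed

lemma L2_norm_nonneg [simp]: "0 \<le> L2_norm h"
  by (simp add: L2_norm_def L2_inner_def)

lemma L2_norm_sq: "(L2_norm h)\<^sup>2 = L2_inner h h"
  by (simp add: L2_norm_def L2_inner_def)

lemma L2_norm_abs: "L2_norm (\<lambda>x. \<bar>h x\<bar>) = L2_norm h"
  by (simp add: L2_norm_def L2_inner_def)

lemma L2_Cauchy_Schwarz:
  assumes "g \<in> L2" "h \<in> L2"
  shows "L2_inner g h \<le> L2_norm g * L2_norm h"
proof -
  define a b d where "a = L2_inner g g" and "b = L2_inner g h" and "d = L2_inner h h"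
  have quad: "0 \<le> a - 2 * t * b + t\<^sup>2 * d" for t
  proof -
    have "0 \<le> (LINT x|I01. (g x - t * h x)\<^sup>2)" by simp
    also have "\<dots> = (LINT x|I01. g x * g x - (2 * t) * (g x * h x) + t\<^sup>2 * (h x * h x))"
      by (simp add: power2_eq_square algebra_simps)
    also have "\<dots> = a - 2 * t * b + t\<^sup>2 * d"
      using assms by (simp add: a_def b_def d_def L2_inner_def L2_integrable_mult)
    finally show ?thesis .
  qed
  have "b\<^sup>2 \<le> a * d"
  proof (cases "d = 0")
    case True
    have "b = 0"
    proof (rule ccontr)
      assume "b \<noteq> 0"
      \<comment> \<open>With d = 0 this value of \<open>t\<close> makes the quadratic equal to
        -1.\<close>
      then show False using quad[of "(a + 1) / (2 * b)"] True by simp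
    qed
    then show ?thesis using True by simp
  next
    case False
    moreover have "0 \<le> d" unfolding d_def L2_norm_sq[symmetric] by simp
    ultimately have d: "0 < d" by simp
    then have "a - 2 * (b / d) * b + (b / d)\<^sup>2 * d = a - b\<^sup>2 / d"
      by (simp add: power2_eq_square)
    then have "b\<^sup>2 / d \<le> a" using quad[of "b / d"] by simp
    then show ?thesis using d by (simp add: pos_divide_le_eq)
  qed
  also have "a * d = (L2_norm g * L2_norm h)\<^sup>2"
    by (simp add: a_def d_def power_mult_distrib L2_norm_sq)
  finally show ?thesis unfolding b_def by (rule power2_le_imp_le) simp
qed

lemma L2_norm_le_add:
  assumes L2: "f \<in> L2" "g \<in> L2" "h \<in> L2"
    and le: "\<And>x. x \<in> {0..1} \<Longrightarrow> \<bar>f x\<bar> \<le> \<bar>g x\<bar> + \<bar>h x\<bar>"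
  shows "L2_norm f \<le> L2_norm g + L2_norm h"
proof (rule power2_le_imp_le)
  have "(L2_norm f)\<^sup>2 \<le> (LINT x|I01. g x * g x + 2 * (\<bar>g x\<bar> * \<bar>h x\<bar>) + h x * h x)"
    unfolding L2_norm_sq L2_inner_def
  proof (rule integral_mono)
    show "integrable I01 (\<lambda>x. g x * g x + 2 * (\<bar>g x\<bar> * \<bar>h x\<bar>) + h x * h x)"
      using L2 by (intro Bochner_Integration.integrable_add integrable_mult_right L2_integrable_mult L2_abs)
    fix x assume "x \<in> space I01"
    then have "\<bar>f x\<bar>\<^sup>2 \<le> (\<bar>g x\<bar> + \<bar>h x\<bar>)\<^sup>2" by (intro power_mono le) auto
    then show "f x * f x \<le> g x * g x + 2 * (\<bar>g x\<bar> * \<bar>h x\<bar>) + h x * h x"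
      by (simp add: power2_sum power2_eq_square algebra_simps)
  qed (use L2 in \<open>intro L2_integrable_mult\<close>)
  also have "\<dots> = L2_inner g g + 2 * L2_inner (\<lambda>x. \<bar>g x\<bar>) (\<lambda>x. \<bar>h x\<bar>) + L2_inner h h"
    by (simp only: L2_inner_def Bochner_Integration.integral_add Bochner_Integration.integrable_add
        integrable_mult_right integral_mult_right_zero L2_integrable_mult L2_abs L2)
  also have "\<dots> \<le> (L2_norm g + L2_norm h)\<^sup>2"
    using L2_Cauchy_Schwarz[OF L2_abs[OF L2(2)] L2_abs[OF L2(3)]]
    by (simp add: power2_sum L2_norm_sq L2_norm_abs)
  finally show "(L2_norm f)\<^sup>2 \<le> (L2_norm g + L2_norm h)\<^sup>2" .
qed simp

lemma L2_norm_le_cmult: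
  assumes L2: "f \<in> L2" "g \<in> L2" and a: "0 \<le> a"
    and le: "\<And>x. x \<in> {0..1} \<Longrightarrow> \<bar>f x\<bar> \<le> a * \<bar>g x\<bar>"
  shows "L2_norm f \<le> a * L2_norm g"
proof (rule power2_le_imp_le)
  have "(L2_norm f)\<^sup>2 \<le> (LINT x|I01. a\<^sup>2 * (g x * g x))"
    unfolding L2_norm_sq L2_inner_def
  proof (rule integral_mono)
    fix x assume "x \<in> space I01"
    then have "\<bar>f x\<bar>\<^sup>2 \<le> (a * \<bar>g x\<bar>)\<^sup>2" by (intro power_mono le) auto
    then show "f x * f x \<le> a\<^sup>2 * (g x * g x)" by (simp add: power2_eq_square mult_ac)
  qed (intro L2_integrable_mult integrable_mult_right L2)+
  also have "\<dots> = (a * L2_norm g)\<^sup>2"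
    by (simp only: power_mult_distrib L2_norm_sq L2_inner_def integral_mult_right_zero)
  finally show "(L2_norm f)\<^sup>2 \<le> (a * L2_norm g)\<^sup>2" .
qed (use a in simp)

lemma LINT_I01_continuous:
  fixes f :: "real \<Rightarrow> real"
  assumes "continuous_on {0..1} f"
  shows "(LINT x|I01. f x) = integral {0..1} f"
  using continuous_imp_integrable_real[OF assms] by (rule lebesgue_integral_eq_integral) simp

lemma L2_norm_exp:
  assumes "M > 0"
  shows "L2_norm (\<lambda>x. M * exp (2 * M * x)) = sqrt (M / 4 * (exp (4 * M) - 1))"
proof -
  have "((\<lambda>x. M * exp (2 * M * x) * (M * exp (2 * M * x))) has_integral
      M / 4 * exp (4 * M * 1) - M / 4 * exp (4 * M * 0)) {0..1}"
  proof (rule fundamental_theorem_of_calculus)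
    fix x :: real
    have "exp (4 * M * x) = exp (2 * M * x) * exp (2 * M * x)" by (simp flip: exp_add)
    then have "((\<lambda>x. M / 4 * exp (4 * M * x)) has_real_derivative
        M * exp (2 * M * x) * (M * exp (2 * M * x))) (at x within {0..1})"
      by (auto intro!: derivative_eq_intros simp: algebra_simps)
    then show "((\<lambda>x. M / 4 * exp (4 * M * x)) has_vector_derivative
        M * exp (2 * M * x) * (M * exp (2 * M * x))) (at x within {0..1})"
      by (simp add: has_real_derivative_iff_has_vector_derivative)
  qed simp
  from integral_unique[OF this]
  have "integral {0..1} (\<lambda>x. M * exp (2 * M * x) * (M * exp (2 * M * x))) = M / 4 * (exp (4 * M) - 1)"
    by (simp only: mult_1_right mult_zero_right exp_zero right_diff_distrib)
  moreover have "continuous_on {0..1} (\<lambda>x. M * exp (2 * M * x) * (M * exp (2 * M * x)))"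
    by (intro continuous_intros)
  ultimately show ?thesis
    unfolding L2_norm_def L2_inner_def
    by (simp only: LINT_I01_continuous)
qed

lemma integrable_I01_subinterval:
  fixes h :: "real \<Rightarrow> real"
  assumes "integrable I01 h" "x \<le> 1"
  shows "integrable (lebesgue_on {0..x}) h"
proof -
  have "set_integrable lebesgue {0..1} h"
    using assms(1) by (simp add: set_integrable_def integrable_restrict_space)
  then have "set_integrable lebesgue {0..x} h"
    by (rule set_integrable_subset) (use assms(2) in auto)
  then show ?thesis
    by (simp add: set_integrable_def integrable_restrict_space)
qed

lemma L2_integral_abs_le_norm:
  assumes h: "h \<in> L2" and x: "x \<in> {0..1}"
  shows "(LINT y|lebesgue_on {0..x}. \<bar>h y\<bar>) \<le> L2_norm h"
proof -
  have one: "L2_norm (\<lambda>_. 1) = 1"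
  proof -
    have "(LINT x|I01. 1 * 1) = integral {0..1::real} (\<lambda>_. 1 * 1 :: real)"
      by (intro LINT_I01_continuous continuous_intros)
    then show ?thesis by (simp add: L2_norm_def L2_inner_def del: lebesgue_integral_const)
  qed
  have int: "integrable I01 (\<lambda>y. \<bar>h y\<bar>)" using L2_integrable[OF L2_abs[OF h]] .
  have "(LINT y|lebesgue_on {0..x}. \<bar>h y\<bar>) = integral {0..x} (\<lambda>y. \<bar>h y\<bar>)"
    using integrable_I01_subinterval[OF int] x by (intro lebesgue_integral_eq_integral) auto
  also have "\<dots> \<le> integral {0..1} (\<lambda>y. \<bar>h y\<bar>)"
    using x integrable_on_lebesgue_on[OF int] integrable_on_lebesgue_on[OF integrable_I01_subinterval[OF int]]
    by (intro integral_subset_le) auto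
  also have "\<dots> = L2_inner (\<lambda>y. \<bar>h y\<bar>) (\<lambda>_. 1)"
    using int by (simp add: L2_inner_def lebesgue_integral_eq_integral)
  also have "\<dots> \<le> L2_norm (\<lambda>y. \<bar>h y\<bar>) * L2_norm (\<lambda>_. 1)"
    by (intro L2_Cauchy_Schwarz L2_abs h continuous_in_L2) auto
  also have "\<dots> = L2_norm h"
    by (simp add: L2_norm_abs one)
  finally show ?thesis .
qed

text \<open>On the unit interval the integral of \<bar>g\<bar> is at most the L2 norm of g. The
  correction term is thus dominated by a constant times one fixed function of x, whose L2 norm is
  the square root in \<open>G\<close>.\<close>

lemma L2_norm_Volterra_le:
  assumes L2: "f \<in> L2" "g \<in> L2" and M: "M > 0"
    and le: "\<And>x. x \<in> {0..1} \<Longrightarrow> \<bar>f x\<bar> \<le> \<bar>g x\<bar> + M * exp (2 * M * x) * (LINT y|lebesgue_on {0..x}. \<bar>g y\<bar>)"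
  shows "L2_norm f \<le> (1 + sqrt (M / 4 * (exp (4 * M) - 1))) * L2_norm g"
proof -
  define h where "h = (\<lambda>x. L2_norm g * (M * exp (2 * M * x)))"
  have h: "h \<in> L2" unfolding h_def by (intro L2_cmult continuous_in_L2 continuous_intros)
  have "L2_norm f \<le> L2_norm g + L2_norm h"
  proof (rule L2_norm_le_add[OF L2 h])
    fix x :: real assume x: "x \<in> {0..1}"
    have "\<bar>f x\<bar> \<le> \<bar>g x\<bar> + M * exp (2 * M * x) * (LINT y|lebesgue_on {0..x}. \<bar>g y\<bar>)" by (rule le[OF x])
    also have "\<dots> \<le> \<bar>g x\<bar> + M * exp (2 * M * x) * L2_norm g"
      using M by (intro add_left_mono mult_left_mono L2_integral_abs_le_norm L2 x) auto
    also have "\<dots> = \<bar>g x\<bar> + \<bar>h x\<bar>" using M by (simp add: h_def abs_mult mult_ac)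
    finally show "\<bar>f x\<bar> \<le> \<bar>g x\<bar> + \<bar>h x\<bar>" .
  qed
  also have "L2_norm h \<le> L2_norm g * L2_norm (\<lambda>x. M * exp (2 * M * x))"
    by (rule L2_norm_le_cmult[OF h]) (auto simp: h_def abs_mult intro!: continuous_in_L2 continuous_intros)
  finally show ?thesis unfolding L2_norm_exp[OF M] by (simp add: algebra_simps)
qed

subsection \<open>The backstepping transformation and its inverse\<close>

text \<open>The conclusion is drawn at the right end only, so that \<open>a\<close> may depend on
  \<open>X\<close>; in the application it is an integral over \<open>{0..X}\<close>.\<close>

lemma Gronwall_const:
  fixes P :: "real \<Rightarrow> real"
  assumes P: "continuous_on {0..X} P" and X: "0 \<le> X"
    and le: "\<And>x. x \<in> {0..X} \<Longrightarrow> P x \<le> a + N * integral {0..x} P" and N: "0 \<le> N"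
  shows "P X \<le> a * exp (N * X)"
proof -
  define R where "R = (\<lambda>x. (a + N * integral {0..x} P) * exp (- N * x))"
  have dR: "(R has_real_derivative N * (P x - (a + N * integral {0..x} P)) * exp (- N * x)) (at x within {0..X})"
    if "x \<in> {0..X}" for x
    unfolding R_def
    by (auto intro!: derivative_eq_intros integral_has_real_derivative[OF P that] simp: algebra_simps)
  have "R X \<le> R 0"
  proof (rule DERIV_nonpos_imp_decreasing_open[where f = R, OF X])
    show "continuous_on {0..X} R" by (rule DERIV_continuous_on) (rule dR)
    fix x assume x: "0 < x" "x < X"
    then have x': "x \<in> {0<..<X}" by simp
    have "(R has_real_derivative N * (P x - (a + N * integral {0..x} P)) * exp (- N * x)) (at x)"
      using DERIV_subset[OF dR[of x], of "{0<..<X}"] x by (simp add: at_within_open[OF x'] subset_eq)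
    moreover have "N * (P x - (a + N * integral {0..x} P)) * exp (- N * x) \<le> 0"
      using le[of x] x N by (intro mult_nonpos_nonneg mult_nonneg_nonpos) auto
    ultimately show "\<exists>y. (R has_real_derivative y) (at x) \<and> y \<le> 0" by blast
  qed
  then have "(a + N * integral {0..X} P) * exp (- N * X) \<le> a" by (simp add: R_def)
  then have "a + N * integral {0..X} P \<le> a * exp (N * X)"
    by (simp add: exp_minus field_simps)
  then show ?thesis using le[of X] X by auto
qed

text \<open>Extending the integrand by zero beyond y = x gives a fixed domain of integration. The
  extension may jump in x only where y = x, a null set, so dominated convergence with bound C
  \<bar>h\<bar> applies.\<close>

lemma continuous_on_Volterra:
  fixes K :: "real \<times> real \<Rightarrow> real" and h :: "real \<Rightarrow> real"
  assumes K: "continuous_on triangle K" and bound: "\<And>z. z \<in> triangle \<Longrightarrow> \<bar>K z\<bar> \<le> C"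
    and h: "integrable I01 h"
  shows "continuous_on {0..1} (\<lambda>x. LINT y|lebesgue_on {0..x}. K (x, y) * h y)"
proof -
  define k where "k = (\<lambda>x y. indicator {0..x} y * (K (x, y) * h y) :: real)"
  have eq: "(LINT y|lebesgue_on {0..x}. K (x, y) * h y) = (LINT y|I01. k x y)" if x: "x \<in> {0..1}" for x
  proof -
    have "lebesgue_on {0..x} = restrict_space I01 {0..x}"
      using x by (simp add: restrict_restrict_space Int_absorb1)
    then show ?thesis using x
      by (simp add: k_def integral_restrict_space[of "{0..x}" I01] sets_restrict_space_iff)
  qed
  have C: "0 \<le> C" using bound[of "(0, 0)"] by (force simp: triangle_def)
  have meas: "k x \<in> borel_measurable I01" if x: "x \<in> {0..1}" for x
  proof -
    have "continuous_on {0..x} (\<lambda>y. K (x, y))"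
      by (rule continuous_on_compose2[OF K]) (use x in \<open>auto intro!: continuous_intros simp: triangle_def\<close>)
    then have "(\<lambda>y. K (x, y)) \<in> borel_measurable (lebesgue_on {0..x})"
      by (rule continuous_imp_measurable_on_sets_lebesgue) simp
    then have "(\<lambda>y. indicator {0..x} y *\<^sub>R K (x, y)) \<in> borel_measurable lebesgue"
      by (simp add: borel_measurable_restrict_space_iff)
    then have "(\<lambda>y. indicator {0..x} y *\<^sub>R K (x, y)) \<in> borel_measurable I01"
      by (rule measurable_restrict_space1)
    then have "(\<lambda>y. (indicator {0..x} y *\<^sub>R K (x, y)) * h y) \<in> borel_measurable I01"
      using h by measurable
    then show ?thesis by (simp add: k_def mult.assoc)
  qed
  have "continuous_on {0..1} (\<lambda>x. LINT y|I01. k x y)"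
    unfolding continuous_on_sequentially
  proof (intro allI ballI impI)
    fix u x assume u: "(\<forall>n. u n \<in> {0..1}) \<and> u \<longlonglongrightarrow> x" and x: "x \<in> {0..1::real}"
    show "((\<lambda>x. LINT y|I01. k x y) \<circ> u) \<longlonglongrightarrow> (LINT y|I01. k x y)"
      unfolding o_def
    proof (rule integral_dominated_convergence[where w = "\<lambda>y. C * \<bar>h y\<bar>"])
      show "integrable I01 (\<lambda>y. C * \<bar>h y\<bar>)" using h by simp
      show "k (u n) \<in> borel_measurable I01" for n using u by (intro meas) auto
      show "AE y in I01. norm (k (u n) y) \<le> C * \<bar>h y\<bar>" for n
      proof (rule AE_I2)
        fix y assume "y \<in> space I01"
        then have y: "0 \<le> y" by simp
        show "norm (k (u n) y) \<le> C * \<bar>h y\<bar>"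
        proof (cases "y \<le> u n")
          case True
          then have "\<bar>K (u n, y)\<bar> \<le> C" using u y by (intro bound) (auto simp: triangle_def)
          then show ?thesis using True y by (auto simp: k_def abs_mult mult_right_mono)
        qed (use C in \<open>auto simp: k_def\<close>)
      qed
      have "AE y in lebesgue. y \<noteq> x"
        by (intro AE_I[of _ _ "{x}"]) auto
      then have "AE y in I01. y \<noteq> x"
        by (simp add: AE_restrict_space_iff) (erule eventually_mono, simp)
      then show "AE y in I01. (\<lambda>n. k (u n) y) \<longlonglongrightarrow> k x y"
      proof (rule AE_mp, intro AE_I2 impI)
        fix y assume yx: "y \<noteq> x" and "y \<in> space I01"
        then have y: "0 \<le> y" "y \<le> 1" by auto
        show "(\<lambda>n. k (u n) y) \<longlonglongrightarrow> k x y"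
        proof (cases "y < x")
          case True
          have ev: "\<forall>\<^sub>F n in sequentially. y < u n" using u True by (intro order_tendstoD) auto
          have "(\<lambda>n. K (u n, y)) \<longlonglongrightarrow> K (x, y)"
          proof (rule continuous_on_tendsto_compose[OF K])
            show "(\<lambda>n. (u n, y)) \<longlonglongrightarrow> (x, y)" using u by (intro tendsto_intros) auto
            show "(x, y) \<in> triangle" using True x y by (auto simp: triangle_def)
            show "\<forall>\<^sub>F n in sequentially. (u n, y) \<in> triangle"
              using ev by eventually_elim (use u y in \<open>auto simp: triangle_def\<close>)
          qed
          then have "(\<lambda>n. K (u n, y) * h y) \<longlonglongrightarrow> k x y"
            using True y by (auto simp: k_def intro: tendsto_intros)
          then show ?thesis
            by (rule Lim_transform_eventually)
              (use ev in eventually_elim, use y in \<open>auto simp: k_def\<close>)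
        next
          case False
          then have "\<forall>\<^sub>F n in sequentially. u n < y" using u yx by (intro order_tendstoD) auto
          then have "\<forall>\<^sub>F n in sequentially. 0 = k (u n) y"
            by eventually_elim (auto simp: k_def)
          then show ?thesis
            using False yx by (intro Lim_transform_eventually[OF tendsto_const]) (auto simp: k_def)
        qed
      qed
    qed (use x in \<open>rule meas\<close>)
  qed
  then show ?thesis by (rule continuous_on_eq) (rule eq[symmetric])
qed

lemma backstepping_in_L2:
  assumes "continuous_on triangle K" "\<And>z. z \<in> triangle \<Longrightarrow> \<bar>K z\<bar> \<le> C" "h \<in> L2"
  shows "backstepping K h \<in> L2"
  unfolding backstepping_def[abs_def]
  by (intro L2_diff continuous_in_L2 continuous_on_Volterra[OF assms(1,2)] L2_integrable assms(3))

lemma integrable_exp_weight: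
  fixes h :: "real \<Rightarrow> real"
  assumes h: "integrable I01 h" and \<beta>: "0 \<le> \<beta>"
  shows "integrable I01 (\<lambda>y. exp (- \<beta> * y) * \<bar>h y\<bar>)"
proof (rule Bochner_Integration.integrable_bound[OF h])
  have "(\<lambda>y::real. exp (- \<beta> * y)) \<in> borel_measurable I01"
    by (intro continuous_imp_measurable_on_sets_lebesgue continuous_intros) simp
  then show "(\<lambda>y. exp (- \<beta> * y) * \<bar>h y\<bar>) \<in> borel_measurable I01" using h by measurable
  show "AE y in I01. norm (exp (- \<beta> * y) * \<bar>h y\<bar>) \<le> norm (h y)"
    using \<beta> by (intro AE_I2) (auto simp: abs_mult intro!: mult_left_le_one_le)
qed

lemma LINT_I01_subinterval:
  fixes h :: "real \<Rightarrow> real"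
  assumes h: "integrable I01 h" and x: "x \<le> 1"
  shows "h integrable_on {0..x}" "(LINT y|lebesgue_on {0..x}. h y) = integral {0..x} h"
  using integrable_I01_subinterval[OF h x]
  by (auto intro: integrable_on_lebesgue_on lebesgue_integral_eq_integral)

text \<open>The convolution form lets exp(\<beta> x) leave the integral. What remains is a running
  integral with an x-independent weight, to which Gronwall with a constant rate can be
  applied.\<close>

lemma Volterra_bound:
  assumes K: "continuous_on triangle K"
    and bound: "\<And>x y. (x, y) \<in> triangle \<Longrightarrow> \<bar>K (x, y)\<bar> \<le> N * exp (\<beta> * (x - y))" and \<beta>: "0 \<le> \<beta>"
    and h: "integrable I01 h" and x: "x \<in> {0..1}"
  shows "\<bar>LINT y|lebesgue_on {0..x}. K (x, y) * h y\<bar>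
    \<le> N * exp (\<beta> * x) * integral {0..x} (\<lambda>y. exp (- \<beta> * y) * \<bar>h y\<bar>)"
proof -
  let ?g = "\<lambda>y. N * exp (\<beta> * x) * (exp (- \<beta> * y) * \<bar>h y\<bar>)"
  note w = integrable_exp_weight[OF h \<beta>]
  have le: "norm (K (x, y) * h y) \<le> ?g y" if "y \<in> {0..x}" for y
  proof -
    have "\<bar>K (x, y)\<bar> * \<bar>h y\<bar> \<le> N * exp (\<beta> * (x - y)) * \<bar>h y\<bar>"
      using that x by (intro mult_right_mono bound) (auto simp: triangle_def)
    also have "exp (\<beta> * (x - y)) = exp (\<beta> * x) * exp (- \<beta> * y)"
      by (simp add: right_diff_distrib flip: exp_add)
    finally show ?thesis by (simp add: abs_mult mult_ac)
  qed
  have g: "integrable (lebesgue_on {0..x}) ?g"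
    using integrable_I01_subinterval[OF w] x by (intro integrable_mult_right) auto
  have "continuous_on {0..x} (\<lambda>y. K (x, y))"
    by (rule continuous_on_compose2[OF K]) (use x in \<open>auto intro!: continuous_intros simp: triangle_def\<close>)
  then have "(\<lambda>y. K (x, y)) \<in> borel_measurable (lebesgue_on {0..x})"
    by (rule continuous_imp_measurable_on_sets_lebesgue) simp
  then have "(\<lambda>y. K (x, y) * h y) \<in> borel_measurable (lebesgue_on {0..x})"
    using borel_measurable_integrable[OF integrable_I01_subinterval[OF h]] x by (intro borel_measurable_times) auto
  then have "integrable (lebesgue_on {0..x}) (\<lambda>y. K (x, y) * h y)"
    by (rule Bochner_Integration.integrable_bound[OF g])
      (intro AE_I2 order_trans[OF le], auto)
  then have "norm (LINT y|lebesgue_on {0..x}. K (x, y) * h y) \<le> (LINT y|lebesgue_on {0..x}. ?g y)"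
    by (intro order_trans[OF integral_norm_bound] integral_mono integrable_norm g le) auto
  also have "\<dots> = N * exp (\<beta> * x) * integral {0..x} (\<lambda>y. exp (- \<beta> * y) * \<bar>h y\<bar>)"
    using LINT_I01_subinterval(2)[OF w] x by (simp only: integral_mult_right_zero atLeastAtMost_iff)
  finally show ?thesis by simp
qed

lemma integral_exp_weight_le:
  fixes h :: "real \<Rightarrow> real"
  assumes h: "integrable I01 h" and \<beta>: "0 \<le> \<beta>" and x: "x \<in> {0..1}"
  shows "integral {0..x} (\<lambda>y. exp (- \<beta> * y) * \<bar>h y\<bar>) \<le> (LINT y|lebesgue_on {0..x}. \<bar>h y\<bar>)"
proof -
  have a: "integrable I01 (\<lambda>y. \<bar>h y\<bar>)" using h by simp
  show ?thesis
    unfolding LINT_I01_subinterval(2)[OF a, of x, OF conjunct2[OF x[unfolded atLeastAtMost_iff]]]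
    using x \<beta> LINT_I01_subinterval(1)[OF a] LINT_I01_subinterval(1)[OF integrable_exp_weight[OF h \<beta>]]
    by (intro integral_le) (auto intro!: mult_left_le_one_le)
qed

lemma backstepping_le:
  assumes K: "continuous_on triangle K"
    and bound: "\<And>x y. (x, y) \<in> triangle \<Longrightarrow> \<bar>K (x, y)\<bar> \<le> N * exp (\<beta> * (x - y))"
    and N: "0 \<le> N" and \<beta>: "0 \<le> \<beta>" and h: "h \<in> L2" and x: "x \<in> {0..1}"
  shows "\<bar>backstepping K h x\<bar> \<le> \<bar>h x\<bar> + N * exp (\<beta> * x) * (LINT y|lebesgue_on {0..x}. \<bar>h y\<bar>)"
proof -
  note hi = L2_integrable[OF h]
  have "N * exp (\<beta> * x) * integral {0..x} (\<lambda>y. exp (- \<beta> * y) * \<bar>h y\<bar>)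
      \<le> N * exp (\<beta> * x) * (LINT y|lebesgue_on {0..x}. \<bar>h y\<bar>)"
    using N by (intro mult_left_mono integral_exp_weight_le hi \<beta> x) auto
  then show ?thesis
    using Volterra_bound[OF K bound \<beta> hi x] unfolding backstepping_def by linarith
qed

text \<open>A kernel bounded by the convolution kernel \<open>N e\<^bsup>\<beta>r\<^esup>\<close> has its resolvent bounded by
  \<open>N e\<^bsup>(N+\<beta>)r\<^esup>\<close>; Gronwall's inequality gives this without constructing the resolvent kernel.\<close>

lemma le_backstepping:
  assumes K: "continuous_on triangle K"
    and bound: "\<And>x y. (x, y) \<in> triangle \<Longrightarrow> \<bar>K (x, y)\<bar> \<le> N * exp (\<beta> * (x - y))"
    and N: "0 \<le> N" and \<beta>: "0 \<le> \<beta>" and h: "h \<in> L2" and x: "x \<in> {0..1}"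
    and L2: "backstepping K h \<in> L2"
  shows "\<bar>h x\<bar> \<le> \<bar>backstepping K h x\<bar>
    + N * exp ((N + \<beta>) * x) * (LINT y|lebesgue_on {0..x}. \<bar>backstepping K h y\<bar>)"
proof -
  define w where "w = backstepping K h"
  \<comment> \<open>Multiplying \<open>le\<close> below by exp(-\<beta> t) cancels the growing
    factor: p \<le> exp(-\<beta> t) \<bar>w t\<bar> + N P t. Integration gives a Gronwall inequality
    for P with rate N, and undoing the weight at the end adds \<beta> to that rate.\<close>
  define p where "p = (\<lambda>y. exp (- \<beta> * y) * \<bar>h y\<bar>)"
  define P where "P = (\<lambda>x. integral {0..x} p)"
  note hi = L2_integrable[OF h]
  have wi: "integrable I01 w" unfolding w_def by (rule L2_integrable[OF L2])
  have p: "integrable I01 p" unfolding p_def by (rule integrable_exp_weight[OF hi \<beta>])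
  have le: "\<bar>h t\<bar> \<le> \<bar>w t\<bar> + N * exp (\<beta> * t) * P t" if "t \<in> {0..1}" for t
    using Volterra_bound[OF K bound \<beta> hi that] unfolding w_def backstepping_def P_def p_def by linarith
  have Pcont: "continuous_on {0..1} P"
    unfolding P_def using LINT_I01_subinterval(1)[OF p, of 1] by (intro indefinite_integral_continuous_1) auto
  define Q where "Q = (LINT y|lebesgue_on {0..x}. \<bar>w y\<bar>)"
  have "P x \<le> Q * exp (N * x)"
  proof (rule Gronwall_const[OF _ _ _ N])
    show "continuous_on {0..x} P" using x by (intro continuous_on_subset[OF Pcont]) auto
    fix t assume t: "t \<in> {0..x}"
    then have t1: "t \<in> {0..1}" using x by auto
    have wt: "(\<lambda>y. exp (- \<beta> * y) * \<bar>w y\<bar>) integrable_on {0..t}"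
      using t1 by (intro LINT_I01_subinterval integrable_exp_weight wi \<beta>) auto
    have Pt: "(\<lambda>y. N * P y) integrable_on {0..t}"
      using t1 by (intro integrable_continuous_real continuous_intros continuous_on_subset[OF Pcont]) auto
    have "P t = integral {0..t} p" by (simp add: P_def)
    also have "\<dots> \<le> integral {0..t} (\<lambda>y. exp (- \<beta> * y) * \<bar>w y\<bar> + N * P y)"
    proof (rule integral_le)
      show "p integrable_on {0..t}" using t1 by (intro LINT_I01_subinterval p) auto
      show "(\<lambda>y. exp (- \<beta> * y) * \<bar>w y\<bar> + N * P y) integrable_on {0..t}"
        by (rule integrable_add[OF wt Pt])
      fix y assume "y \<in> {0..t}"
      then have "exp (- \<beta> * y) * \<bar>h y\<bar> \<le> exp (- \<beta> * y) * (\<bar>w y\<bar> + N * exp (\<beta> * y) * P y)"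
        using t1 by (intro mult_left_mono le) auto
      also have "\<dots> = exp (- \<beta> * y) * \<bar>w y\<bar> + (exp (- \<beta> * y) * exp (\<beta> * y)) * (N * P y)"
        by (simp only: distrib_left mult_ac)
      finally show "p y \<le> exp (- \<beta> * y) * \<bar>w y\<bar> + N * P y"
        by (simp add: p_def flip: exp_add)
    qed
    also have "\<dots> = integral {0..t} (\<lambda>y. exp (- \<beta> * y) * \<bar>w y\<bar>) + N * integral {0..t} P"
      using Henstock_Kurzweil_Integration.integral_add[OF wt Pt] by simp
    also have "integral {0..t} (\<lambda>y. exp (- \<beta> * y) * \<bar>w y\<bar>) \<le> integral {0..x} (\<lambda>y. exp (- \<beta> * y) * \<bar>w y\<bar>)"
      using t x by (intro integral_subset_le wt LINT_I01_subinterval integrable_exp_weight wi \<beta>) auto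
    also have "\<dots> \<le> Q" unfolding Q_def by (rule integral_exp_weight_le[OF wi \<beta> x])
    finally show "P t \<le> Q + N * integral {0..t} P" by simp
  qed (use x in simp)
  then have "N * exp (\<beta> * x) * P x \<le> N * exp (\<beta> * x) * (Q * exp (N * x))"
    using N by (intro mult_left_mono) auto
  also have "\<dots> = N * exp ((N + \<beta>) * x) * Q" by (simp add: distrib_right exp_add)
  finally show ?thesis using le[OF x] unfolding Q_def w_def by linarith
qed

lemma backstepping_norm_bounds:
  assumes K: "continuous_on triangle K" and M: "M > 0"
    and bound: "\<And>x y. (x, y) \<in> triangle \<Longrightarrow> \<bar>K (x, y)\<bar> \<le> 3 * M / 4 * exp ((M + 1/4) * (x - y))"
    and h: "h \<in> L2"
  defines "G \<equiv> 1 + sqrt (M / 4 * (exp (4 * M) - 1))"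
  shows "backstepping K h \<in> L2"
    and "L2_norm (backstepping K h) \<le> G * L2_norm h"
    and "L2_norm h \<le> G * L2_norm (backstepping K h)"
proof -
  have "\<bar>K z\<bar> \<le> 3 * M / 4 * exp (M + 1/4)" if "z \<in> triangle" for z
  proof -
    obtain x y where z: "z = (x, y)" by (cases z)
    have "\<bar>K (x, y)\<bar> \<le> 3 * M / 4 * exp ((M + 1/4) * (x - y))" using that z by (intro bound) simp
    also have "(M + 1/4) * (x - y) \<le> (M + 1/4) * 1"
      using M that z by (intro mult_left_mono) (auto simp: triangle_def)
    finally show ?thesis using M z by simp
  qed
  then show L2: "backstepping K h \<in> L2" by (rule backstepping_in_L2[OF K _ h])
  \<comment> \<open>Inverts 1 - 1/4 \<le> exp(-1/4); the 4/3 cancels the factor 3/4 of the kernel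
    bound.\<close>
  have quarter: "exp (1/4 :: real) \<le> 4/3"
    using exp_ge_add_one_self[of "-1/4 :: real"] by (simp add: exp_minus field_simps)
  \<comment> \<open>Used with k = M + 1/4 for the transformation and with k = 7M/4 + 1/4 for its
    inverse; the condition on \<open>k\<close> is sharp for the latter.\<close>
  have const: "3 * M / 4 * exp (k * x) \<le> M * exp (2 * M * x)"
    if "k \<le> 7/4 * M + 1/4" "x \<in> {0..1}" for k x
  proof -
    have Mx: "0 \<le> M * x" using that M by simp
    have "k * x \<le> (7/4 * M + 1/4) * x" using that by (intro mult_right_mono) auto
    also have "\<dots> = 7/4 * (M * x) + x / 4" by (simp add: algebra_simps)
    also have "\<dots> \<le> 1/4 + 2 * (M * x)" using Mx that by simp
    finally have "exp (k * x) \<le> exp (1/4) * exp (2 * M * x)" by (simp add: mult.assoc flip: exp_add)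
    also have "\<dots> \<le> 4/3 * exp (2 * M * x)" using quarter by simp
    finally show ?thesis using M by simp
  qed
  have nonneg: "0 \<le> (LINT y|lebesgue_on {0..x}. \<bar>g y\<bar>)" for g :: "real \<Rightarrow> real" and x by simp
  show "L2_norm (backstepping K h) \<le> G * L2_norm h" unfolding G_def
  proof (rule L2_norm_Volterra_le[OF L2 h M])
    fix x :: real assume x: "x \<in> {0..1}"
    have "\<bar>backstepping K h x\<bar> \<le> \<bar>h x\<bar> + 3 * M / 4 * exp ((M + 1/4) * x) * (LINT y|lebesgue_on {0..x}. \<bar>h y\<bar>)"
      by (rule backstepping_le[OF K bound _ _ h x]) (use M in auto)
    also have "\<dots> \<le> \<bar>h x\<bar> + M * exp (2 * M * x) * (LINT y|lebesgue_on {0..x}. \<bar>h y\<bar>)"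
      by (intro add_left_mono mult_right_mono const x nonneg) (use M in auto)
    finally show "\<bar>backstepping K h x\<bar> \<le> \<bar>h x\<bar> + M * exp (2 * M * x) * (LINT y|lebesgue_on {0..x}. \<bar>h y\<bar>)" .
  qed
  show "L2_norm h \<le> G * L2_norm (backstepping K h)" unfolding G_def
  proof (rule L2_norm_Volterra_le[OF h L2 M])
    fix x :: real assume x: "x \<in> {0..1}"
    have "\<bar>h x\<bar> \<le> \<bar>backstepping K h x\<bar>
        + 3 * M / 4 * exp ((3 * M / 4 + (M + 1/4)) * x) * (LINT y|lebesgue_on {0..x}. \<bar>backstepping K h y\<bar>)"
      by (rule le_backstepping[OF K bound _ _ h x L2]) (use M in auto)
    also have "\<dots> \<le> \<bar>backstepping K h x\<bar> + M * exp (2 * M * x) * (LINT y|lebesgue_on {0..x}. \<bar>backstepping K h y\<bar>)"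
      by (intro add_left_mono mult_right_mono const x nonneg) auto
    finally show "\<bar>h x\<bar> \<le> \<bar>backstepping K h x\<bar>
        + M * exp (2 * M * x) * (LINT y|lebesgue_on {0..x}. \<bar>backstepping K h y\<bar>)" .
  qed
qed

subsection \<open>The dwell time\<close>

theorem proposition3p1:
  fixes act :: actuation and q :: ereal
    and \<epsilon> c lambar \<phi> \<mu>1 \<mu> G R :: real
    and lam :: "real \<Rightarrow> real \<Rightarrow> real"
  assumes "\<epsilon> > 0" and "q > - \<infinity>"
    and "c \<ge> c_lower_bound act \<epsilon> q"
    and "continuous_on ({0..} \<times> {0..1}) (\<lambda>(t, x). lam t x)"
    and "\<And>t. t \<ge> 0 \<Longrightarrow> \<exists>d. continuous_on {0..1} d \<and>
           (\<forall>x\<in>{0..1}. (lam t has_real_derivative d x) (at x within {0..1}))"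
    and "lambar > 0"
    and "\<And>t x. t \<ge> 0 \<Longrightarrow> x \<in> {0..1} \<Longrightarrow> \<bar>lam t x\<bar> \<le> lambar"
    and "\<phi> > 0"
    and "\<And>t s x. t \<ge> 0 \<Longrightarrow> s \<ge> 0 \<Longrightarrow> x \<in> {0..1} \<Longrightarrow> \<bar>lam t x - lam s x\<bar> \<le> \<phi> * \<bar>t - s\<bar>"
    and "is_smallest_eigenvalue act q \<mu>1"
    and "\<mu> = c + \<epsilon> * \<mu>1"
    and "G = gain_bound \<epsilon> c lambar"
    and "0 < R" and "R < 1"
  shows "\<exists>\<tau>>0. \<tau> = 1 / \<phi> * (\<mu> * R / G\<^sup>2) \<and>
           (\<forall>u0 te K v u. u0 \<in> L2 \<and> closed_loop act \<epsilon> q c lam \<mu> R u0 te K v u \<longrightarrow>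
              (\<forall>j. te j < \<infinity> \<longrightarrow> te (Suc j) - te j \<ge> ereal \<tau>))"
proof -
  define M where "M = (lambar + c) / \<epsilon>"
  have c: "\<epsilon> * (qbar q)\<^sup>2 \<le> c"
    using assms(1,3) by (cases act) auto
  have c0: "0 \<le> c" using order_trans[OF _ c] assms(1) by simp
  have M0: "M > 0" using assms(1,6) c0 by (simp add: M_def)
  have qM: "(qbar q)\<^sup>2 \<le> M" using c assms(1,6) by (simp add: M_def field_simps)
  have G: "G = 1 + sqrt (M / 4 * (exp (4 * M) - 1))"
    by (simp add: assms(12) gain_bound_def M_def)
  have G1: "1 \<le> G" unfolding G using M0 by simp
  have \<mu>: "\<mu> > 0"
    unfolding assms(11) using eigenvalue_shift_pos[OF assms(2,1,3)] assms(10)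
    by (simp add: is_smallest_eigenvalue_def)
  define \<tau> where "\<tau> = 1 / \<phi> * (\<mu> * R / G\<^sup>2)"
  have \<tau>: "\<tau> > 0" unfolding \<tau>_def using assms(8,13) \<mu> G1 by simp
  have lamcont: "continuous_on {0..1} (lam t)" if "0 \<le> t" for t
    using assms(5)[OF that] by (blast intro: DERIV_continuous_on)
  have trigger: "t - tj > \<tau>"
    if ker: "is_kernel \<epsilon> q c (lam tj) K" and v: "\<And>t. t \<ge> tj \<Longrightarrow> v t \<in> L2"
      and t: "t \<in> trigger_set lam \<mu> R tj K v" and tj: "0 \<le> tj" for K v t tj
  proof -
    have ttj: "t > tj" using t by (simp add: trigger_set_def)
    have contK: "continuous_on triangle K"
      using ker by (auto simp: is_kernel_def C2_triangle_def C1_triangle_def intro: differentiable_imp_continuous_on)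
    have bound: "\<bar>K (x, y)\<bar> \<le> 3 * M / 4 * exp ((M + 1/4) * (x - y))" if "(x, y) \<in> triangle" for x y
    proof (rule kernel_bound[OF assms(1,2) ker lamcont[OF tj] M0 qM _ that])
      fix y :: real assume "y \<in> {0..1}"
      then have "\<bar>lam tj y\<bar> \<le> lambar" by (rule assms(7)[OF tj])
      then show "\<bar>lam tj y + c\<bar> / \<epsilon> \<le> M"
        unfolding M_def using c0 assms(1) by (intro divide_right_mono) auto
    qed
    define f where "f = (\<lambda>x. (lam t x - lam tj x) * v t x)"
    define w where "w = backstepping K (v t)"
    have vL2: "v t \<in> L2" using v ttj by simp
    have le: "\<bar>f x\<bar> \<le> \<phi> * (t - tj) * \<bar>v t x\<bar>" if "x \<in> {0..1}" for x
      using assms(9)[of t tj x] ttj tj that by (auto simp: f_def abs_mult intro!: mult_right_mono)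
    have fL2: "f \<in> L2"
    proof -
      have "continuous_on {0..1} (\<lambda>x. lam t x - lam tj x)"
        using tj ttj by (intro continuous_intros lamcont) auto
      then have "(\<lambda>x. lam t x - lam tj x) \<in> borel_measurable I01"
        by (rule continuous_imp_measurable_on_sets_lebesgue) simp
      then have meas: "f \<in> borel_measurable I01"
        unfolding f_def using vL2 by (auto simp: L2_def)
      moreover have "integrable I01 (\<lambda>x. (f x)\<^sup>2)"
      proof (rule Bochner_Integration.integrable_bound)
        show "integrable I01 (\<lambda>x. (\<phi> * (t - tj))\<^sup>2 * (v t x)\<^sup>2)" using vL2 by (simp add: L2_def)
        show "(\<lambda>x. (f x)\<^sup>2) \<in> borel_measurable I01" using meas by simp
        show "AE x in I01. norm ((f x)\<^sup>2) \<le> norm ((\<phi> * (t - tj))\<^sup>2 * (v t x)\<^sup>2)"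
        proof (rule AE_I2)
          fix x assume "x \<in> space I01"
          then have "\<bar>f x\<bar>\<^sup>2 \<le> (\<phi> * (t - tj) * \<bar>v t x\<bar>)\<^sup>2" by (intro power_mono le) auto
          then show "norm ((f x)\<^sup>2) \<le> norm ((\<phi> * (t - tj))\<^sup>2 * (v t x)\<^sup>2)"
            by (simp add: power_mult_distrib abs_mult)
        qed
      qed
      ultimately show ?thesis by (simp add: L2_def)
    qed
    note bs = backstepping_norm_bounds[OF contK M0 bound, folded G]
    have vw: "L2_norm (v t) \<le> G * L2_norm w" unfolding w_def by (rule bs(3)[OF _ vL2])
    have "L2_norm (backstepping K f) \<le> G * L2_norm f" by (rule bs(2)[OF _ fL2])
    also have "\<dots> \<le> G * (\<phi> * (t - tj) * L2_norm (v t))"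
      using G1 assms(8) ttj by (intro mult_left_mono L2_norm_le_cmult fL2 vL2 le) auto
    also have "\<dots> \<le> G * (\<phi> * (t - tj) * (G * L2_norm w))"
      using G1 assms(8) ttj vw by (intro mult_left_mono) auto
    finally have "L2_norm w * L2_norm (backstepping K f) \<le> L2_norm w * (G * (\<phi> * (t - tj) * (G * L2_norm w)))"
      by (rule mult_left_mono) simp
    moreover have "L2_inner w (backstepping K f) \<le> L2_norm w * L2_norm (backstepping K f)"
      unfolding w_def by (intro L2_Cauchy_Schwarz bs(1)[OF _ vL2] bs(1)[OF _ fL2])
    moreover have "\<mu> * R * (L2_norm w)\<^sup>2 < L2_inner w (backstepping K f)"
      using t by (simp add: trigger_set_def w_def f_def)
    ultimately have "\<mu> * R * (L2_norm w)\<^sup>2 < G\<^sup>2 * \<phi> * (t - tj) * (L2_norm w)\<^sup>2"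
      by (simp add: power2_eq_square mult_ac)
    \<comment> \<open>The triggering inequality is strict, which already excludes w = 0, so the
      squared norm may be cancelled knowing only that it is nonnegative.\<close>
    then have "\<mu> * R < G\<^sup>2 * \<phi> * (t - tj)"
      by (rule mult_right_less_imp_less) simp
    moreover have "0 < G\<^sup>2 * \<phi>" using G1 assms(8) by simp
    ultimately show ?thesis unfolding \<tau>_def by (simp add: divide_less_eq mult_ac)
  qed
  have "te (Suc j) - te j \<ge> ereal \<tau>"
    if cl: "closed_loop act \<epsilon> q c lam \<mu> R u0 te K v u" and fin: "te j < \<infinity>" for u0 te K v u j
  proof -
    have step: "te (Suc j) \<ge> ereal (tj + \<tau>)" if tej: "te j = ereal tj" and tj: "0 \<le> tj" for j tj
    proof -
      let ?S = "trigger_set lam \<mu> R tj (K j) (v j)"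
      have ker: "is_kernel \<epsilon> q c (lam tj) (K j)"
        and plant: "plant_solution act \<epsilon> q lam (\<lambda>t. feedback act (K j) (v j t)) tj \<infinity> {} (v j)"
        and next_event: "te (Suc j) = (if ?S = {} then \<infinity> else ereal (Inf ?S))"
        using cl tej unfolding closed_loop_def Let_def by blast+
      have "v j t \<in> L2" if "t \<ge> tj" for t using plant that unfolding plant_solution_def by simp
      from trigger[OF ker this _ tj] have "tj + \<tau> \<le> Inf ?S" if "?S \<noteq> {}"
        using that by (intro cInf_greatest) force+
      then show ?thesis using next_event by simp
    qed
    \<comment> \<open>The bounds on \<open>lam\<close> are assumed for nonnegative times, so
      \<open>step\<close> requires 0 \<le> tj. The induction also rules out the value -\<infinity>
      for an event time, so that \<open>te j\<close> < \<infinity> means a real time.\<close>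
    have nonneg: "0 \<le> te i" for i
    proof (induction i)
      case 0 show ?case using cl by (simp add: closed_loop_def)
    next
      case (Suc i)
      show ?case
      proof (cases "te i")
        case (real r)
        then have "ereal (r + \<tau>) \<le> te (Suc i)" using Suc step by simp
        then show ?thesis using Suc real \<tau> by (auto elim: order_trans[rotated])
      next
        case PInf
        then have "te (Suc i) = \<infinity>" using cl by (simp add: closed_loop_def)
        then show ?thesis by simp
      qed (use Suc in simp)
    qed
    obtain tj where tj: "te j = ereal tj" using fin nonneg[of j] by (cases "te j") auto
    then have "ereal (tj + \<tau>) \<le> te (Suc j)" using step nonneg[of j] by simp
    then show ?thesis using tj by (cases "te (Suc j)") auto
  qed
  then show ?thesis using \<tau> by (intro exI[of _ \<tau>]) (auto simp: \<tau>_def)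
qed

end
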